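(* Fix an integer $k\ge2$ and a function $\alpha(n)>0$, let $d=\alpha(n)\log_2 n$ and $p=\left(1-2^{-2k/\alpha(n)}\right)^{1/k}$, and assume $p\le 1/2$ so that the planted distribution is defined. There is an algorithm which, given an instance $U\sim k\text{-OV}_1^\alpha(n)$, outputs $(s_1,\dots,s_k)\in[n]^k$ with $U_{1,s_1},\dots,U_{k,s_k}$ orthogonal, and runs in expected time $O\!\left(n^{k-\frac{k}{1+\alpha(n)}}\right)$, the expectation taken over the instance.
   Context: Vectors $u_1,\dots,u_k\in\{0,1\}^d$ are orthogonal if for every $j\in[d]$, $\prod_{\ell}u_\ell[j]=0$. A $k$-OV instance is a tuple of matrices $U_1,\dots,U_k\in\{0,1\}^{n\times d}$, $U_{\ell,i}$ the $i$-th row of $U_\ell$. The model distribution $k\text{-OV}_0^\alpha(n)$ samples all entries independently, each $1$ with probability $p$. $\mathsf{Plant}(U_1,\dots,U_k,s_1,\dots,s_k)$: for each coordinate $j$ independently, let $m$ be the number of ones among $U_{1,s_1}[j],\dots,U_{k,s_k}[j]$; if $k-m$ is even, flip $U_{k,s_k}[j]$ with probability $(p/(1-p))^{k-m}$; return the instance. The planted distribution $k\text{-OV}_1^\alpha(n)$ samples from $k\text{-OV}_0^\alpha(n)$, picks $(s_1,\dots,s_k)$ uniformly in $[n]^k$, and applies $\mathsf{Plant}$. *)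

theory Defs
  imports "HOL-Probability.Probability" "HOL-Library.Landau_Symbols"
begin

section \<open>Orthogonal vectors and the planted distribution\<close>

text \<open>
  All index sets are 0-based: the index set of size \<open>n\<close> is \<open>{..<n}\<close>, and the last of the
  \<open>k\<close> matrices has index \<open>k - 1\<close>. An instance is \<open>U\<close> with \<open>U l i j\<close> being the \<open>j\<close>-th bit of the
  \<open>i\<close>-th row of the \<open>l\<close>-th matrix; only \<open>l < k\<close>, \<open>i < n\<close>, \<open>j < d\<close> are meaningful, and the
  distributions below put \<open>False\<close> everywhere else.
\<close>

type_synonym kov_inst = "nat \<Rightarrow> nat \<Rightarrow> nat \<Rightarrow> bool"

definition orthogonal_vecs :: "nat \<Rightarrow> nat \<Rightarrow> (nat \<Rightarrow> nat \<Rightarrow> bool) \<Rightarrow> bool" where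
  "orthogonal_vecs k d u \<longleftrightarrow> (\<forall>j<d. (\<Prod>l<k. of_bool (u l j) :: nat) = 0)"

text \<open>The dimension is \<open>\<alpha>(n) log\<^sub>2 n\<close>, rounded up to an integer.\<close>

definition kov_dim :: "(nat \<Rightarrow> real) \<Rightarrow> nat \<Rightarrow> nat" where
  "kov_dim \<alpha> n = nat \<lceil>\<alpha> n * log 2 (real n)\<rceil>"

definition kov_prob :: "nat \<Rightarrow> (nat \<Rightarrow> real) \<Rightarrow> nat \<Rightarrow> real" where
  "kov_prob k \<alpha> n = (1 - 2 powr (- 2 * real k / \<alpha> n)) powr (1 / real k)"

definition kov0 :: "nat \<Rightarrow> (nat \<Rightarrow> real) \<Rightarrow> nat \<Rightarrow> kov_inst pmf" where
  "kov0 k \<alpha> n =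
     map_pmf (\<lambda>f l i j. f (l, i, j))
       (Pi_pmf ({..<k} \<times> {..<n} \<times> {..<kov_dim \<alpha> n}) False
          (\<lambda>_. bernoulli_pmf (kov_prob k \<alpha> n)))"

definition flip_pmf :: "nat \<Rightarrow> real \<Rightarrow> nat \<Rightarrow> bool pmf" where
  "flip_pmf k p m =
     (if even (k - m) then bernoulli_pmf ((p / (1 - p)) ^ (k - m)) else return_pmf False)"

definition plant :: "nat \<Rightarrow> nat \<Rightarrow> real \<Rightarrow> kov_inst \<Rightarrow> (nat \<Rightarrow> nat) \<Rightarrow> kov_inst pmf" where
  "plant k d p U s =
     map_pmf
       (\<lambda>F l i j. if l = k - 1 \<and> i = s (k - 1) \<and> F j then \<not> U l i j else U l i j)
       (Pi_pmf {..<d} False (\<lambda>j. flip_pmf k p (card {l. l < k \<and> U l (s l) j})))"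

definition kov1 :: "nat \<Rightarrow> (nat \<Rightarrow> real) \<Rightarrow> nat \<Rightarrow> kov_inst pmf" where
  "kov1 k \<alpha> n =
     bind_pmf (kov0 k \<alpha> n) (\<lambda>U.
     bind_pmf (pmf_of_set ({..<k} \<rightarrow>\<^sub>E {..<n})) (\<lambda>s.
       plant k (kov_dim \<alpha> n) (kov_prob k \<alpha> n) U s))"


section \<open>Word RAM\<close>

text \<open>
  Algorithms are programs of a deterministic word RAM in structured form. A state consists of
  registers (named by constants of the program) and a memory addressed by words. With word
  length \<open>w\<close>, all results are reduced modulo \<open>2 ^ w\<close>. Every arithmetic, comparison, bitwise or
  shift operation, every access to a register or memory cell and every branch costs one unit.
  A program is a single finite text, so it does not depend on the input or on its size.
\<close>

type_synonym ram_state = "(nat \<Rightarrow> nat) \<times> (nat \<Rightarrow> nat)"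

datatype ram_op = Add | Sub | Mul | Div | Mod | BAnd | BOr | BXor | Shl | Shr | Less | Equal

datatype ram_exp = Lit nat | Reg nat | Load ram_exp | Bin ram_op ram_exp ram_exp

datatype ram_prog =
    Skip
  | Assign nat ram_exp
  | Store ram_exp ram_exp
  | Then ram_prog ram_prog
  | Cond ram_exp ram_prog ram_prog
  | Loop ram_exp ram_prog

unbundle bit_operations_syntax

fun ram_op_val :: "nat \<Rightarrow> ram_op \<Rightarrow> nat \<Rightarrow> nat \<Rightarrow> nat" where
  "ram_op_val w Add x y = (x + y) mod 2 ^ w"
| "ram_op_val w Sub x y = nat ((int x - int y) mod 2 ^ w)"
| "ram_op_val w Mul x y = (x * y) mod 2 ^ w"
| "ram_op_val w Div x y = (x div y) mod 2 ^ w"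
| "ram_op_val w Mod x y = (x mod y) mod 2 ^ w"
| "ram_op_val w BAnd x y = (x AND y) mod 2 ^ w"
| "ram_op_val w BOr x y = (x OR y) mod 2 ^ w"
| "ram_op_val w BXor x y = (x XOR y) mod 2 ^ w"
| "ram_op_val w Shl x y = (x * 2 ^ y) mod 2 ^ w"
| "ram_op_val w Shr x y = (x div 2 ^ y) mod 2 ^ w"
| "ram_op_val w Less x y = of_bool (x < y) mod 2 ^ w"
| "ram_op_val w Equal x y = of_bool (x = y) mod 2 ^ w"

unbundle no bit_operations_syntax

fun ram_val :: "nat \<Rightarrow> ram_state \<Rightarrow> ram_exp \<Rightarrow> nat" where
  "ram_val w \<sigma> (Lit v) = v mod 2 ^ w"
| "ram_val w \<sigma> (Reg x) = fst \<sigma> x mod 2 ^ w"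
| "ram_val w \<sigma> (Load e) = snd \<sigma> (ram_val w \<sigma> e) mod 2 ^ w"
| "ram_val w \<sigma> (Bin f e1 e2) = ram_op_val w f (ram_val w \<sigma> e1) (ram_val w \<sigma> e2)"

fun ram_cost :: "ram_exp \<Rightarrow> nat" where
  "ram_cost (Lit v) = 1"
| "ram_cost (Reg x) = 1"
| "ram_cost (Load e) = 1 + ram_cost e"
| "ram_cost (Bin f e1 e2) = 1 + ram_cost e1 + ram_cost e2"

text \<open>
  \<open>ram_exec w P \<sigma> t \<sigma>'\<close>: started in \<open>\<sigma>\<close> with word length \<open>w\<close>, the program \<open>P\<close> halts after
  exactly \<open>t\<close> units of time in state \<open>\<sigma>'\<close>.
\<close>

inductive ram_exec :: "nat \<Rightarrow> ram_prog \<Rightarrow> ram_state \<Rightarrow> nat \<Rightarrow> ram_state \<Rightarrow> bool" for w where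
  Skip: "ram_exec w Skip \<sigma> 1 \<sigma>"
| Assign: "ram_exec w (Assign x e) (r, m) (1 + ram_cost e) (r(x := ram_val w (r, m) e), m)"
| Store: "ram_exec w (Store a e) (r, m) (1 + ram_cost a + ram_cost e)
            (r, m(ram_val w (r, m) a := ram_val w (r, m) e))"
| Then: "ram_exec w P \<sigma> t \<sigma>' \<Longrightarrow> ram_exec w Q \<sigma>' t' \<sigma>'' \<Longrightarrow> ram_exec w (Then P Q) \<sigma> (t + t') \<sigma>''"
| Cond_True: "ram_val w \<sigma> e \<noteq> 0 \<Longrightarrow> ram_exec w P \<sigma> t \<sigma>' \<Longrightarrow>
            ram_exec w (Cond e P Q) \<sigma> (1 + ram_cost e + t) \<sigma>'"
| Cond_False: "ram_val w \<sigma> e = 0 \<Longrightarrow> ram_exec w Q \<sigma> t \<sigma>' \<Longrightarrow>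
            ram_exec w (Cond e P Q) \<sigma> (1 + ram_cost e + t) \<sigma>'"
| Loop_True: "ram_val w \<sigma> e \<noteq> 0 \<Longrightarrow> ram_exec w P \<sigma> t \<sigma>' \<Longrightarrow> ram_exec w (Loop e P) \<sigma>' t' \<sigma>'' \<Longrightarrow>
            ram_exec w (Loop e P) \<sigma> (1 + ram_cost e + t + t') \<sigma>''"
| Loop_False: "ram_val w \<sigma> e = 0 \<Longrightarrow> ram_exec w (Loop e P) \<sigma> (1 + ram_cost e) \<sigma>"

lemma ram_exec_deterministic:
  "ram_exec w P \<sigma> t \<sigma>' \<Longrightarrow> ram_exec w P \<sigma> t' \<sigma>'' \<Longrightarrow> t' = t \<and> \<sigma>'' = \<sigma>'"
proof (induction arbitrary: t' \<sigma>'' rule: ram_exec.induct)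
  case (Skip \<sigma>)
  from Skip.prems show ?case by cases auto
next
  case (Assign x e r m)
  from Assign.prems show ?case by cases auto
next
  case (Store a e r m)
  from Store.prems show ?case by cases auto
next
  case (Then P \<sigma> t \<sigma>1 Q u \<sigma>2)
  from Then.prems show ?case by cases (use Then.IH in blast)
next
  case (Cond_True \<sigma> e P t \<sigma>1 Q)
  from Cond_True.prems show ?case
    by cases (use Cond_True.hyps Cond_True.IH in blast)+
next
  case (Cond_False \<sigma> e Q t \<sigma>1 P)
  from Cond_False.prems show ?case
    by cases (use Cond_False.hyps Cond_False.IH in blast)+
next
  case (Loop_True \<sigma> e P t \<sigma>1 u \<sigma>2)
  from Loop_True.prems show ?case
    by cases (use Loop_True.hyps Loop_True.IH in blast)+
next
  case (Loop_False \<sigma> e P)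
  from Loop_False.prems show ?case
    by cases (use Loop_False.hyps in blast)+
qed


section \<open>Input and output conventions\<close>

text \<open>
  Word length \<open>c\<close> times \<open>log\<^sub>2 n + \<alpha>(n)\<close>, rounded. This is \<open>\<Theta>(log n)\<close> whenever
  \<open>\<alpha>(n) = O(log n)\<close>; for larger \<open>\<alpha>(n)\<close> the exponent \<open>k - k / (1 + \<alpha>(n))\<close> only gives
  \<open>\<Theta>(n\<^sup>k)\<close>. The term \<open>\<alpha>(n)\<close> cannot be dropped for arbitrary \<open>\<alpha>\<close>: a certified answer
  requires inspecting at least \<open>\<alpha>(n) log\<^sub>2 n\<close> bits.
\<close>

definition word_len :: "nat \<Rightarrow> (nat \<Rightarrow> real) \<Rightarrow> nat \<Rightarrow> nat" where
  "word_len c \<alpha> n = c * nat \<lceil>log 2 (real n) + \<alpha> n\<rceil>"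

definition words_per_row :: "nat \<Rightarrow> nat \<Rightarrow> nat" where
  "words_per_row w d = (d + w - 1) div w"

text \<open>
  Rows are packed, \<open>w\<close> bits per word with the lowest coordinate in the least significant bit,
  and stored consecutively from address 0, one matrix after the other. Registers 0, 1, 2
  hold \<open>n\<close>, \<open>d\<close> and \<open>w\<close>. Everything else is initially 0.
\<close>

definition packed_word :: "nat \<Rightarrow> nat \<Rightarrow> (nat \<Rightarrow> bool) \<Rightarrow> nat \<Rightarrow> nat" where
  "packed_word w d v q = (\<Sum>b<w. of_bool (q * w + b < d \<and> v (q * w + b)) * 2 ^ b)"

definition input_mem :: "nat \<Rightarrow> nat \<Rightarrow> nat \<Rightarrow> nat \<Rightarrow> kov_inst \<Rightarrow> nat \<Rightarrow> nat" where
  "input_mem w k n d U a =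
     (let h = words_per_row w d in
      if a < k * n * h
      then packed_word w d (U (a div h div n) (a div h mod n)) (a mod h)
      else 0)"

definition input_state :: "nat \<Rightarrow> nat \<Rightarrow> nat \<Rightarrow> nat \<Rightarrow> kov_inst \<Rightarrow> ram_state" where
  "input_state w k n d U = ((\<lambda>_. 0)(0 := n, 1 := d, 2 := w), input_mem w k n d U)"

text \<open>The answer is read off registers \<open>0, \<dots>, k - 1\<close>.\<close>

definition output_of :: "ram_state \<Rightarrow> nat \<Rightarrow> nat" where
  "output_of \<sigma> = fst \<sigma>"

end

theory Submission
  imports Defs
begin

text \<open>
  Let \<open>4 ^ t \<le> n < 4 ^ (t + 1)\<close>. For every mask of \<open>t\<close> bits, tabulate the rows of the last matrix
  whose first \<open>t\<close> coordinates are disjoint from the mask; this costs \<open>O(n * 2 ^ t)\<close>. Then run through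
  all choices of rows in the first \<open>k - 1\<close> matrices, take the conjunction of their first \<open>t\<close>
  coordinates as a mask, and test the tabulated rows word by word, stopping at the first nonzero word.

  The assumption \<open>p \<le> 1/2\<close> forces \<open>\<alpha> \<ge> 2 k\<close>, so the allowed time is at least \<open>n ^ (k - 1/2)\<close>. This pays
  for the table and also for all tuples through the modified row of the last matrix, each scanned in
  full. The other tuples behave as in the null model: a tuple is orthogonal on its first \<open>r\<close>
  coordinates with probability \<open>2 powr (- 2 k r / \<alpha>)\<close>. Hence about \<open>n ^ (k - k / \<alpha>)\<close> of them pass the
  mask test, and since \<open>w \<ge> log n + \<alpha>\<close>, the number of words scanned for a tuple has a geometric tail.
\<close>

subsection \<open>Reasoning about programs\<close>

text \<open>The length \<open>t\<close> balances two costs: tabulating takes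
  \<open>n * 2 ^ t\<close>, while a longer mask lets fewer tuples through. With \<open>2 ^ t\<close>
  about the square root of \<open>n\<close>, a null-model tuple passes with probability
  \<open>2 powr (- 2 k t / \<alpha>)\<close>, roughly \<open>n powr (- k / \<alpha>)\<close>, and
  \<open>k / \<alpha>\<close> exceeds \<open>k / (1 + \<alpha>)\<close>.

  The obstacle is that planting depends on the columns of the chosen tuple, so the modified row is
  not independent of the others. No probability is therefore computed in the planted model: planted
  and null instance are compared pointwise, before any expectation is taken. For this the running
  time is bounded by a sum, over all tuples, of a cost depending only on the rows of that tuple. A
  search that goes on after its first success fits this form. Linearity of expectation then
  suffices, without independence between tuples.\<close>

definition runs :: "nat \<Rightarrow> ram_prog \<Rightarrow> nat \<Rightarrow> ram_state \<Rightarrow> (ram_state \<Rightarrow> bool) \<Rightarrow> bool" where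
  "runs w P b \<sigma> R \<longleftrightarrow> (\<exists>t \<sigma>'. ram_exec w P \<sigma> t \<sigma>' \<and> t \<le> b \<and> R \<sigma>')"

lemma runs_mono:
  assumes "runs w P b \<sigma> R" and "b \<le> b'" and "\<And>\<sigma>'. R \<sigma>' \<Longrightarrow> R' \<sigma>'"
  shows "runs w P b' \<sigma> R'"
  using assms unfolding runs_def by (meson le_trans)

text \<open>The second program is judged inside the postcondition of the first, as with weakest
  preconditions, so a sequence gets by without named intermediate assertions.\<close>

lemma runs_Then:
  assumes "runs w P b \<sigma> (\<lambda>\<sigma>'. runs w Q b' \<sigma>' R)"
  shows "runs w (Then P Q) (b + b') \<sigma> R"
  using assms unfolding runs_def by (meson add_mono ram_exec.Then)

lemma runs_Cond_True:
  assumes "ram_val w \<sigma> e \<noteq> 0" "runs w P b \<sigma> R"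
  shows "runs w (Cond e P Q) (1 + ram_cost e + b) \<sigma> R"
  using assms unfolding runs_def by (meson add_left_mono ram_exec.Cond_True)

lemma runs_Cond_False:
  assumes "ram_val w \<sigma> e = 0" "runs w Q b \<sigma> R"
  shows "runs w (Cond e P Q) (1 + ram_cost e + b) \<sigma> R"
  using assms unfolding runs_def by (meson add_left_mono ram_exec.Cond_False)

text \<open>The values of \<open>prog_cost\<close> and \<open>run\<close> on loops are junk.\<close>

fun loop_free :: "ram_prog \<Rightarrow> bool" where
  "loop_free Skip = True"
| "loop_free (Assign x e) = True"
| "loop_free (Store a e) = True"
| "loop_free (Then P Q) = (loop_free P \<and> loop_free Q)"
| "loop_free (Cond e P Q) = (loop_free P \<and> loop_free Q)"
| "loop_free (Loop e P) = False"

fun prog_cost :: "ram_prog \<Rightarrow> nat" where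
  "prog_cost Skip = 1"
| "prog_cost (Assign x e) = 1 + ram_cost e"
| "prog_cost (Store a e) = 1 + ram_cost a + ram_cost e"
| "prog_cost (Then P Q) = prog_cost P + prog_cost Q"
| "prog_cost (Cond e P Q) = 1 + ram_cost e + prog_cost P + prog_cost Q"
| "prog_cost (Loop e P) = 0"

fun run :: "nat \<Rightarrow> ram_prog \<Rightarrow> ram_state \<Rightarrow> ram_state" where
  "run w Skip \<sigma> = \<sigma>"
| "run w (Assign x e) \<sigma> = ((fst \<sigma>)(x := ram_val w \<sigma> e), snd \<sigma>)"
| "run w (Store a e) \<sigma> = (fst \<sigma>, (snd \<sigma>)(ram_val w \<sigma> a := ram_val w \<sigma> e))"
| "run w (Then P Q) \<sigma> = run w Q (run w P \<sigma>)"
| "run w (Cond e P Q) \<sigma> = (if ram_val w \<sigma> e \<noteq> 0 then run w P \<sigma> else run w Q \<sigma>)"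
| "run w (Loop e P) \<sigma> = \<sigma>"

lemma loop_free_exec:
  "loop_free P \<Longrightarrow> \<exists>t \<le> prog_cost P. ram_exec w P \<sigma> t (run w P \<sigma>)"
proof (induction P arbitrary: \<sigma>)
  case Skip
  then show ?case using ram_exec.Skip[of w \<sigma>] by auto
next
  case (Assign x e)
  then show ?case using ram_exec.Assign[of w x e "fst \<sigma>" "snd \<sigma>"] by auto
next
  case (Store a e)
  then show ?case using ram_exec.Store[of w a e "fst \<sigma>" "snd \<sigma>"] by auto
next
  case (Then P Q)
  then obtain t t' where "t \<le> prog_cost P" "ram_exec w P \<sigma> t (run w P \<sigma>)"
    "t' \<le> prog_cost Q" "ram_exec w Q (run w P \<sigma>) t' (run w Q (run w P \<sigma>))"
    by (metis loop_free.simps(4))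
  then show ?case by (auto intro!: exI[of _ "t + t'"] ram_exec.Then)
next
  case (Cond e P Q)
  then obtain t t' where *: "t \<le> prog_cost P" "ram_exec w P \<sigma> t (run w P \<sigma>)"
    "t' \<le> prog_cost Q" "ram_exec w Q \<sigma> t' (run w Q \<sigma>)"
    by (metis loop_free.simps(5))
  show ?case
  proof (cases "ram_val w \<sigma> e = 0")
    case True
    then show ?thesis using ram_exec.Cond_False[OF True *(4), of P] *(3)
      by (intro exI[of _ "1 + ram_cost e + t'"]) simp
  next
    case False
    then show ?thesis using ram_exec.Cond_True[OF False *(2), of Q] *(1)
      by (intro exI[of _ "1 + ram_cost e + t"]) simp
  qed
qed auto

lemma runs_loop_free:
  assumes "loop_free P" and "R (run w P \<sigma>)" and "prog_cost P \<le> b"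
  shows "runs w P b \<sigma> R"
  unfolding runs_def using loop_free_exec[OF assms(1), of w \<sigma>] assms(2,3) by (meson le_trans)

text \<open>Fixing the number \<open>N\<close> of iterations in advance builds termination in. The
  bounds \<open>c i\<close> may differ between iterations, because the time spent on a list of the
  table depends on its entries.\<close>

lemma runs_Loop:
  assumes start: "I 0 \<sigma>"
    and test: "\<And>i \<sigma>. i < N \<Longrightarrow> I i \<sigma> \<Longrightarrow> ram_val w \<sigma> e \<noteq> 0"
    and step: "\<And>i \<sigma>. i < N \<Longrightarrow> I i \<sigma> \<Longrightarrow> runs w P (c i) \<sigma> (I (Suc i))"
    and stop: "\<And>\<sigma>. I N \<sigma> \<Longrightarrow> ram_val w \<sigma> e = 0"
  shows "runs w (Loop e P) ((\<Sum>i<N. c i) + (N + 1) * (1 + ram_cost e)) \<sigma> (I N)"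
proof -
  \<comment> \<open>Induction on the number \<open>j\<close> of iterations still to come, so that
    \<open>Loop_True\<close> peels off the first of them.\<close>
  have "runs w (Loop e P) ((\<Sum>i=N-j..<N. c i) + (j + 1) * (1 + ram_cost e)) \<sigma> (I N)"
    if "j \<le> N" "I (N - j) \<sigma>" for j \<sigma>
    using that
  proof (induction j arbitrary: \<sigma>)
    case 0
    then have "ram_exec w (Loop e P) \<sigma> (1 + ram_cost e) \<sigma>"
      using stop[of \<sigma>] ram_exec.Loop_False[of w \<sigma> e P] by simp
    with 0 show ?case unfolding runs_def by fastforce
  next
    case (Suc j)
    let ?i = "N - Suc j"
    have i: "?i < N" "Suc ?i = N - j" using Suc.prems by auto
    obtain t \<sigma>1 where 1: "ram_exec w P \<sigma> t \<sigma>1" "t \<le> c ?i" "I (N - j) \<sigma>1"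
      using step[OF i(1) Suc.prems(2)] i(2) unfolding runs_def by auto
    obtain t' \<sigma>2 where 2: "ram_exec w (Loop e P) \<sigma>1 t' \<sigma>2" "I N \<sigma>2"
      "t' \<le> (\<Sum>i=N-j..<N. c i) + (j + 1) * (1 + ram_cost e)"
      using Suc.IH[OF _ 1(3)] Suc.prems unfolding runs_def by auto
    have "ram_exec w (Loop e P) \<sigma> (1 + ram_cost e + t + t') \<sigma>2"
      by (rule ram_exec.Loop_True[OF test[OF i(1) Suc.prems(2)] 1(1) 2(1)])
    moreover have "(\<Sum>i=?i..<N. c i) = c ?i + (\<Sum>i=N-j..<N. c i)"
      using i by (simp add: sum.atLeast_Suc_lessThan)
    ultimately show ?case using 1(2) 2(2,3) unfolding runs_def
      by (intro exI[of _ "1 + ram_cost e + t + t'"] exI[of _ \<sigma>2]) (auto simp: algebra_simps)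
  qed
  from this[of N \<sigma>] start show ?thesis by (simp add: lessThan_atLeast0)
qed

subsection \<open>Tuples of rows and packed words\<close>

text \<open>A choice of one row from each of the \<open>k\<close> matrices is encoded by a number \<open>y < n ^ k\<close>,
  whose base-\<open>n\<close> digits are the row indices.\<close>

unbundle bit_operations_syntax

definition digit :: "nat \<Rightarrow> nat \<Rightarrow> nat \<Rightarrow> nat" where
  "digit n l y = y div n ^ l mod n"

lemma digit_less: "0 < n \<Longrightarrow> digit n l y < n"
  by (simp add: digit_def)

lemma digit_add_high:
  assumes "l < m" "0 < n"
  shows "digit n l (x + i * n ^ m) = digit n l x"
proof -
  obtain r where m: "m = l + Suc r" using assms(1) less_iff_Suc_add by auto
  have "x + i * n ^ m = x + (i * n ^ r * n) * n ^ l" by (simp add: m power_add)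
  then have "(x + i * n ^ m) div n ^ l = x div n ^ l + i * n ^ r * n"
    using assms(2) by (metis div_mult_self1 power_not_zero gr_implies_not0 add.commute)
  then show ?thesis by (simp add: digit_def)
qed

lemma digit_add_top:
  assumes "x < n ^ m" "i < n"
  shows "digit n m (x + i * n ^ m) = i"
  using assms by (simp add: digit_def)

text \<open>Injectivity by removing the top digit; surjectivity then by counting, since both sides
  have \<open>n ^ k\<close> elements.\<close>

lemma bij_betw_digits:
  assumes "0 < n"
  shows "bij_betw (\<lambda>y. \<lambda>l\<in>{..<k}. digit n l y) {..<n ^ k} ({..<k} \<rightarrow>\<^sub>E {..<n})"
proof -
  have inj: "y = z" if "y < n ^ k" "z < n ^ k" "\<forall>l<k. digit n l y = digit n l z" for y z
    using that
  proof (induction k arbitrary: y z)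
    case (Suc k)
    have eq: "u = u mod n ^ k + digit n k u * n ^ k" if "u < n ^ Suc k" for u
      using that by (simp add: digit_def less_mult_imp_div_less mult.commute)
    have m: "digit n l (u mod n ^ k) = digit n l u" if "l < k" for l u
      using digit_add_high[OF that assms, of "u mod n ^ k" "u div n ^ k"]
      by (metis mod_div_mult_eq)
    have "y mod n ^ k = z mod n ^ k"
      by (rule Suc.IH) (use Suc.prems assms m in auto)
    then show ?case using eq[OF Suc.prems(1)] eq[OF Suc.prems(2)] Suc.prems(3) by (metis lessI)
  qed auto
  have "inj_on (\<lambda>y. \<lambda>l\<in>{..<k}. digit n l y) {..<n ^ k}"
  proof (rule inj_onI)
    fix y z assume yz: "y \<in> {..<n ^ k}" "z \<in> {..<n ^ k}"
      and eq: "(\<lambda>l\<in>{..<k}. digit n l y) = (\<lambda>l\<in>{..<k}. digit n l z)"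
    have "digit n l y = digit n l z" if "l < k" for l
      using fun_cong[OF eq, of l] that by simp
    then show "y = z" using inj yz by blast
  qed
  moreover have "(\<lambda>y. \<lambda>l\<in>{..<k}. digit n l y) ` {..<n ^ k} = {..<k} \<rightarrow>\<^sub>E {..<n}"
  proof (rule card_subset_eq)
    show "(\<lambda>y. \<lambda>l\<in>{..<k}. digit n l y) ` {..<n ^ k} \<subseteq> {..<k} \<rightarrow>\<^sub>E {..<n}"
      using digit_less[OF assms] by (auto split: if_splits)
  qed (use calculation in \<open>auto simp: finite_PiE card_image card_PiE\<close>)
  ultimately show ?thesis by (simp add: bij_betw_def)
qed

lemma bit_packed_word:
  "bit (packed_word w d v q) b \<longleftrightarrow> b < w \<and> q * w + b < d \<and> v (q * w + b)"
proof -
  have "packed_word w d v q =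
      horner_sum of_bool 2 (map (\<lambda>b. q * w + b < d \<and> v (q * w + b)) [0..<w])"
    by (simp add: packed_word_def horner_sum_eq_sum lessThan_atLeast0)
  then show ?thesis by (auto simp: bit_horner_sum_bit_iff)
qed

lemma packed_word_less: "packed_word w d v q < 2 ^ w"
proof -
  have "take_bit w (packed_word w d v q) = packed_word w d v q"
    by (rule bit_eqI) (auto simp: bit_take_bit_iff bit_packed_word)
  then show ?thesis by (metis take_bit_nat_less_exp)
qed

lemma and_le_left: "(a AND b :: nat) \<le> a"
proof -
  have "int (a AND b) \<le> int a" by (simp add: of_nat_and_eq AND_upper1)
  then show ?thesis by simp
qed

text \<open>The last argument is the index of the last matrix included: \<open>k - 1\<close> gives
  the whole tuple, \<open>k - 2\<close> everything but the row of the last matrix. A set bit marks a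
  coordinate in which all included rows have a one.\<close>

fun and_words :: "nat \<Rightarrow> nat \<Rightarrow> nat \<Rightarrow> kov_inst \<Rightarrow> nat \<Rightarrow> nat \<Rightarrow> nat \<Rightarrow> nat" where
  "and_words n d w U y q 0 = packed_word w d (U 0 (digit n 0 y)) q"
| "and_words n d w U y q (Suc m) =
     and_words n d w U y q m AND packed_word w d (U (Suc m) (digit n (Suc m) y)) q"

lemma bit_and_words:
  "bit (and_words n d w U y q m) b \<longleftrightarrow>
     b < w \<and> q * w + b < d \<and> (\<forall>l\<le>m. U l (digit n l y) (q * w + b))"
  by (induction m) (auto simp: bit_and_iff bit_packed_word le_Suc_eq)

lemma and_words_less: "and_words n d w U y q m < 2 ^ w"
  by (induction m) (auto simp: packed_word_less intro: le_less_trans[OF and_le_left])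

lemma and_words_cong:
  "(\<And>l. l \<le> m \<Longrightarrow> digit n l y = digit n l z) \<Longrightarrow> and_words n d w U y q m = and_words n d w U z q m"
  by (induction m) auto

lemma orthogonal_vecs_iff: "orthogonal_vecs k d u \<longleftrightarrow> (\<forall>j<d. \<exists>l<k. \<not> u l j)"
  by (auto simp: orthogonal_vecs_def)

lemma orthogonal_vecs_cong:
  "(\<And>l. l < k \<Longrightarrow> u l = v l) \<Longrightarrow> orthogonal_vecs k d u = orthogonal_vecs k d v"
  unfolding orthogonal_vecs_iff by (intro all_cong1 imp_cong refl ex_cong1 conj_cong) simp

lemma ex_digits:
  assumes "0 < n" "\<And>l. l < k \<Longrightarrow> s l < n"
  obtains y where "y < n ^ k" "\<And>l. l < k \<Longrightarrow> digit n l y = s l"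
proof -
  have "(\<lambda>l\<in>{..<k}. s l) \<in> (\<lambda>y. \<lambda>l\<in>{..<k}. digit n l y) ` {..<n ^ k}"
    using bij_betw_digits[OF assms(1), of k] assms(2) by (auto simp: bij_betw_def)
  then obtain y where y: "y < n ^ k" "(\<lambda>l\<in>{..<k}. s l) = (\<lambda>l\<in>{..<k}. digit n l y)" by auto
  have "digit n l y = s l" if "l < k" for l using fun_cong[OF y(2), of l] that by simp
  with y(1) that show thesis by blast
qed

text \<open>With \<open>m = n ^ (k - 1)\<close> this matches the program: \<open>x\<close> chooses
  the first \<open>k - 1\<close> rows and \<open>i\<close>, the top digit, the row of the last
  matrix.\<close>

lemma sum_digit_split:
  fixes f :: "nat \<Rightarrow> nat"
  shows "(\<Sum>y<n * m. f y) = (\<Sum>x<m. \<Sum>i<n. f (x + i * m))"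
proof -
  have "(\<Sum>y<n * m. f y) = (\<Sum>i<n. \<Sum>y\<in>{i * m..<i * m + m}. f y)"
    by (rule sum.nat_group[symmetric])
  also have "\<dots> = (\<Sum>i<n. \<Sum>x<m. f (x + i * m))"
  proof (rule sum.cong[OF refl])
    fix i
    show "(\<Sum>y\<in>{i * m..<i * m + m}. f y) = (\<Sum>x<m. f (x + i * m))"
      using sum.shift_bounds_nat_ivl[of f 0 "i * m" m] by (simp add: lessThan_atLeast0 add.commute[of m])
  qed
  also have "\<dots> = (\<Sum>x<m. \<Sum>i<n. f (x + i * m))" by (rule sum.swap)
  finally show ?thesis .
qed

lemma words_per_row_bounds:
  assumes "0 < w" "0 < d"
  shows "words_per_row w d \<le> d" "words_per_row w d * w \<le> d + w - 1"
proof -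
  show *: "words_per_row w d * w \<le> d + w - 1" by (simp add: words_per_row_def)
  obtain d' w' where "d = Suc d'" "w = Suc w'" using assms by (meson gr0_implies_Suc)
  \<comment> \<open>This is \<open>(d - 1) * (w - 1) \<ge> 0\<close>.\<close>
  then have "d + w - 1 \<le> d * w" by simp
  with * have "words_per_row w d * w \<le> d * w" by linarith
  then show "words_per_row w d \<le> d" using assms(1) by simp
qed

text \<open>Only the last word of a row is padded, so all words before word \<open>q\<close> consist
  of genuine coordinates.\<close>

lemma mult_le_if_less_words_per_row:
  assumes "q < words_per_row w d"
  shows "q * w \<le> d"
proof -
  have "(q + 1) * w \<le> words_per_row w d * w" using assms by (intro mult_le_mono) auto
  also have "\<dots> \<le> d + w - 1" by (simp add: words_per_row_def)
  finally show ?thesis by (cases "w = 0") auto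
qed

subsection \<open>The program\<close>

text \<open>
  Register \<open>k + r\<close> holds, for \<open>r = 3, \<dots>, 16\<close>: \<open>n\<close>, \<open>d\<close>, \<open>w\<close>, the number of words per row, the base
  address of the table, the number \<open>2 ^ t\<close> of masks, \<open>n ^ (k - 1)\<close>, the current mask, the current
  row (while the table is filled), the position in the current list of the table, the tuple of the
  first \<open>k - 1\<close> rows, the full tuple, the current word, and the answer. The list of mask \<open>v\<close> starts
  \<open>v * (n + 1)\<close> cells after the base address and ends with the sentinel \<open>n\<close>.
\<close>

fun pow_exp :: "nat \<Rightarrow> nat \<Rightarrow> ram_exp" where
  "pow_exp k 0 = Lit 1"
| "pow_exp k (Suc l) = Bin Mul (pow_exp k l) (Reg (k + 3))"

definition digit_exp :: "nat \<Rightarrow> nat \<Rightarrow> nat \<Rightarrow> ram_exp" where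
  "digit_exp k r l = Bin Mod (Bin Div (Reg r) (pow_exp k l)) (Reg (k + 3))"

definition row_exp :: "nat \<Rightarrow> nat \<Rightarrow> ram_exp \<Rightarrow> ram_exp \<Rightarrow> ram_exp" where
  "row_exp k l i q =
     Load (Bin Add (Bin Mul (Bin Add (Bin Mul (Lit l) (Reg (k + 3))) i) (Reg (k + 6))) q)"

text \<open>Unrolled over the matrices instead of looping: \<open>k\<close> is fixed, so both the
  size and the cost of the expression are constants.\<close>

fun and_exp :: "nat \<Rightarrow> nat \<Rightarrow> ram_exp \<Rightarrow> nat \<Rightarrow> ram_exp" where
  "and_exp k r q 0 = row_exp k 0 (digit_exp k r 0) q"
| "and_exp k r q (Suc m) =
     Bin BAnd (and_exp k r q m) (row_exp k (Suc m) (digit_exp k r (Suc m)) q)"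

definition entry_exp :: "nat \<Rightarrow> ram_exp" where
  "entry_exp k = Bin Add (Bin Add (Reg (k + 7))
     (Bin Mul (Reg (k + 10)) (Bin Add (Reg (k + 3)) (Lit 1)))) (Reg (k + 12))"

definition incr :: "nat \<Rightarrow> ram_prog" where
  "incr r = Assign r (Bin Add (Reg r) (Lit 1))"

text \<open>The input is moved above register \<open>k + 2\<close>, clear of registers 0 to 2, which
  hold it on entry, and of registers 0 to \<open>k - 1\<close>, which receive the answer.\<close>

definition init_prog :: "nat \<Rightarrow> ram_prog" where
  "init_prog k =
     Then (Assign (k + 3) (Reg 0)) (
     Then (Assign (k + 4) (Reg 1)) (
     Then (Assign (k + 5) (Reg 2)) (
     Then (Assign (k + 6) (Bin Div (Bin Sub (Bin Add (Reg 1) (Reg 2)) (Lit 1)) (Reg 2))) (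
     Then (Assign (k + 7) (Bin Mul (Bin Mul (Lit k) (Reg (k + 3))) (Reg (k + 6))))
          (Assign (k + 8) (Lit 1))))))"

text \<open>Finds the largest power of two whose square is at most \<open>n\<close>.
  \<open>Less\<close> against \<open>n + 1\<close> stands for a weak inequality.\<close>

definition double_prog :: "nat \<Rightarrow> ram_prog" where
  "double_prog k =
     Loop (Bin Less (Bin Mul (Bin Mul (Lit 4) (Reg (k + 8))) (Reg (k + 8)))
                    (Bin Add (Reg (k + 3)) (Lit 1)))
       (Assign (k + 8) (Bin Mul (Lit 2) (Reg (k + 8))))"

definition fill_step :: "nat \<Rightarrow> ram_prog" where
  "fill_step k =
     Then (Cond (Bin Equal (Bin BAnd (row_exp k (k - 1) (Reg (k + 11)) (Lit 0)) (Reg (k + 10))) (Lit 0))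
            (Then (Store (entry_exp k) (Reg (k + 11))) (incr (k + 12))) Skip)
          (incr (k + 11))"

definition fill_init :: "nat \<Rightarrow> ram_prog" where
  "fill_init k = Then (Assign (k + 11) (Lit 0)) (Assign (k + 12) (Lit 0))"

definition fill_end :: "nat \<Rightarrow> ram_prog" where
  "fill_end k = Then (Store (entry_exp k) (Reg (k + 3))) (incr (k + 10))"

definition table_prog :: "nat \<Rightarrow> ram_prog" where
  "table_prog k =
     Loop (Bin Less (Reg (k + 10)) (Reg (k + 8)))
       (Then (fill_init k)
       (Then (Loop (Bin Less (Reg (k + 11)) (Reg (k + 3))) (fill_step k))
             (fill_end k)))"

definition scan_init :: "nat \<Rightarrow> ram_prog" where
  "scan_init k = Then (Assign (k + 14) (Bin Add (Reg (k + 13)) (Bin Mul (Load (entry_exp k)) (Reg (k + 9)))))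
                      (Assign (k + 15) (Lit 0))"

text \<open>At the last test the word index is out of range and the loaded words are junk; the left conjunct
  makes the result zero.\<close>

definition scan_test :: "nat \<Rightarrow> ram_exp" where
  "scan_test k = Bin BAnd (Bin Less (Reg (k + 15)) (Reg (k + 6)))
                   (Bin Equal (and_exp k (k + 14) (Reg (k + 15)) (k - 1)) (Lit 0))"

text \<open>The word index reaches the number of words per row exactly when all words were zero. A
  later success overwrites an earlier one.\<close>

definition scan_end :: "nat \<Rightarrow> ram_prog" where
  "scan_end k = Then (Cond (Bin Equal (Reg (k + 15)) (Reg (k + 6))) (Assign (k + 16) (Reg (k + 14))) Skip)
                     (incr (k + 12))"

definition bucket_init :: "nat \<Rightarrow> ram_prog" where
  "bucket_init k = Then (Assign (k + 10) (Bin Mod (and_exp k (k + 13) (Lit 0) (k - 2)) (Reg (k + 8))))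
                        (Assign (k + 12) (Lit 0))"

definition bucket_test :: "nat \<Rightarrow> ram_exp" where
  "bucket_test k = Bin Less (Load (entry_exp k)) (Reg (k + 3))"

definition bucket_step :: "nat \<Rightarrow> ram_prog" where
  "bucket_step k =
     Then (scan_init k) (Then (Loop (scan_test k) (incr (k + 15))) (scan_end k))"

definition search_prog :: "nat \<Rightarrow> ram_prog" where
  "search_prog k =
     Loop (Bin Less (Reg (k + 13)) (Reg (k + 9)))
       (Then (bucket_init k)
       (Then (Loop (bucket_test k) (bucket_step k))
             (incr (k + 13))))"

fun output_prog :: "nat \<Rightarrow> nat \<Rightarrow> ram_prog" where
  "output_prog k 0 = Skip"
| "output_prog k (Suc l) = Then (output_prog k l) (Assign l (digit_exp k (k + 16) l))"

definition setup_prog :: "nat \<Rightarrow> ram_prog" where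
  "setup_prog k = Then (Assign (k + 9) (pow_exp k (k - 1)))
     (Then (Assign (k + 10) (Lit 0)) (Then (Assign (k + 13) (Lit 0)) (Assign (k + 16) (Lit 0))))"

text \<open>The guard catches dimension 0, which occurs for \<open>n = 1\<close>. The answer
  register is then still 0, so row 0 is output from every matrix, and orthogonality is
  vacuous.\<close>

definition kov_prog :: "nat \<Rightarrow> ram_prog" where
  "kov_prog k =
     Then (init_prog k)
     (Then (Cond (Reg (k + 4))
              (Then (double_prog k) (Then (setup_prog k) (Then (table_prog k) (search_prog k)))) Skip)
           (output_prog k k))"

subsection \<open>Correctness and running time\<close>

text \<open>This and the next three constants depend on \<open>k\<close> alone. The added numerals
  leave room for loop tests and register increments.\<close>

definition "fill_cost k = prog_cost (fill_init k) + prog_cost (fill_step k) + prog_cost (fill_end k) + 30"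

definition "scan_cost k = prog_cost (scan_init k) + prog_cost (scan_end k) + 10 + ram_cost (scan_test k)"

definition "bucket_cost k = prog_cost (bucket_init k) + 10 + ram_cost (bucket_test k)"

definition time_const :: "nat \<Rightarrow> nat" where
  "time_const k = prog_cost (init_prog k) + prog_cost (setup_prog k) + 2 * fill_cost k +
     bucket_cost k + (scan_cost k + bucket_cost k) + prog_cost (output_prog k k) + 80"

definition orth_upto :: "nat \<Rightarrow> nat \<Rightarrow> kov_inst \<Rightarrow> nat \<Rightarrow> nat \<Rightarrow> bool" where
  "orth_upto k n U y r \<longleftrightarrow> (\<forall>j<r. \<exists>l<k. \<not> U l (digit n l y) j)"

text \<open>
  Dominates one plus the number of words scanned for a tuple that passes the mask test: word \<open>q\<close>
  is found to be zero only if the previous ones were, so the first \<open>q * w\<close> coordinates are orthogonal.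
\<close>

definition tuple_cost :: "nat \<Rightarrow> nat \<Rightarrow> nat \<Rightarrow> nat \<Rightarrow> nat \<Rightarrow> kov_inst \<Rightarrow> nat \<Rightarrow> nat" where
  "tuple_cost k n w h t U y = 2 * of_bool (orth_upto k n U y t) +
     (\<Sum>q\<in>{1..<h}. of_bool (orth_upto k n U y (q * w)))"

text \<open>The bookkeeping of \<open>kov_prog_correct\<close> with its nonlinear terms replaced by
  variables. The numerals add up to at most \<open>78 * x\<close>, rounded to the 80 in
  \<open>time_const\<close>.\<close>

lemma cost_arith:
  fixes x :: nat
  assumes "t \<le> x" "p \<le> x" "m \<le> x" "1 \<le> x" and "pf \<le> xf" "mb \<le> xb"
    and "ci \<le> xi" "cs \<le> xs" "co \<le> xo" "sS \<le> zS" "b \<le> mb + sS + (m + 1) * 4"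
  shows "ci + ((2 + ((t + 1) * 30 + (cs + ((pf + (p + 1) * 4) + b)))) + co)
    \<le> xi + xs + xf + xb + xo + 80 * x + zS"
proof -
  have "ci + ((2 + ((t + 1) * 30 + (cs + ((pf + (p + 1) * 4) + b)))) + co) =
      ci + cs + pf + co + b + 30 * t + 4 * p + 36" by (simp add: algebra_simps)
  moreover have "b \<le> mb + sS + 4 * m + 4" using assms(11) by simp
  ultimately show ?thesis using assms(1-10) by linarith
qed

text \<open>\<open>fits\<close> adds up all relevant magnitudes: addresses of the input and the
  table, tuple numbers, and the values read on entry. Hence arithmetic on meaningful values never
  wraps around, and each single bound follows linearly.\<close>

locale kov_run =
  fixes k n d w t :: nat and U :: kov_inst
  assumes k: "2 \<le> k" and n: "1 \<le> n" and d: "1 \<le> d" and w: "1 \<le> w"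
    and t: "4 ^ t \<le> n" "n < 4 ^ Suc t"
    and fits: "k * n * words_per_row w d + 4 * (n + 1) * (n + 1) + n ^ k + d + w + k < 2 ^ w"
begin

abbreviation "h \<equiv> words_per_row w d"
abbreviation "W l i q \<equiv> packed_word w d (U l i) q"
abbreviation "A m y q \<equiv> and_words n d w U y q m"

lemma two_t: "2 ^ t * 2 ^ t \<le> n" "n < 4 * 2 ^ t * 2 ^ t" "2 ^ t \<le> n"
proof -
  show 1: "2 ^ t * 2 ^ t \<le> n" using t(1) by (simp flip: power_mult_distrib)
  show "n < 4 * 2 ^ t * 2 ^ t" using t(2) by (simp add: power_mult_distrib[symmetric] mult.assoc)
  have "2 ^ t * 1 \<le> (2 ^ t * 2 ^ t :: nat)" by (intro mult_le_mono2) simp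
  with 1 show "2 ^ t \<le> n" by linarith
qed

lemma fits': "n < 2 ^ w" "n + 1 < 2 ^ w" "h < 2 ^ w" "k < 2 ^ w" "d < 2 ^ w" "w < 2 ^ w" "d + w < 2 ^ w"
    "k * n * h < 2 ^ w" "n ^ k < 2 ^ w" "(1 :: nat) < 2 ^ w" "4 * (n + 1) * (n + 1) < 2 ^ w" "k * n < 2 ^ w"
proof -
  have "h \<le> k * n * h" using k n by simp
  moreover have "h \<ge> 1" using d w by (simp add: words_per_row_def div_greater_zero_iff Suc_le_eq)
  moreover have "k * n * 1 \<le> k * n * h" by (rule mult_le_mono2) fact
  moreover have "n + 1 \<le> 4 * (n + 1) * (n + 1)" by simp
  ultimately show "n < 2 ^ w" "n + 1 < 2 ^ w" "h < 2 ^ w" "k < 2 ^ w" "d < 2 ^ w" "w < 2 ^ w" "d + w < 2 ^ w"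
    "k * n * h < 2 ^ w" "n ^ k < 2 ^ w" "(1 :: nat) < 2 ^ w" "4 * (n + 1) * (n + 1) < 2 ^ w" "k * n < 2 ^ w"
    using fits w by linarith+
qed

text \<open>A mask is cut out of the first word of a row, so its \<open>t\<close> bits must fit
  there.\<close>

lemma t_less: "t < w"
proof -
  have "(2 :: nat) ^ t < 2 ^ w" using two_t(3) fits' by linarith
  then show ?thesis by simp
qed

lemma entry_addr:
  assumes "v < 2 ^ t" "j \<le> n"
  shows "k * n * h + v * (n + 1) + j < 2 ^ w" "v * (n + 1) < 2 ^ w"
proof -
  have "v * (n + 1) + j < (v + 1) * (n + 1)" using assms by simp
  also have "\<dots> \<le> n * (n + 1)" using assms two_t(3) by (intro mult_le_mono) auto
  also have "\<dots> \<le> 4 * (n + 1) * (n + 1)" by (intro mult_le_mono) auto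
  finally show "k * n * h + v * (n + 1) + j < 2 ^ w" "v * (n + 1) < 2 ^ w" using fits by linarith+
qed

lemma row_addr:
  assumes "l < k" "i < n" "q < h"
  shows "(l * n + i) * h + q < k * n * h" "(l * n + i) * h < 2 ^ w" "l * n + i < 2 ^ w" "l * n < 2 ^ w"
proof -
  have "l * n + i + 1 \<le> l * n + n" using assms by simp
  also have "\<dots> = (l + 1) * n" by simp
  also have "\<dots> \<le> k * n" using assms by (intro mult_le_mono) auto
  finally have 1: "l * n + i + 1 \<le> k * n" .
  have "(l * n + i) * h + q < (l * n + i + 1) * h" using assms by simp
  also have "\<dots> \<le> k * n * h" using 1 by (intro mult_le_mono) auto
  finally show 2: "(l * n + i) * h + q < k * n * h" .
  show "(l * n + i) * h < 2 ^ w" "l * n + i < 2 ^ w" "l * n < 2 ^ w" using 1 2 fits' by linarith+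
qed

section \<open>Values of the expressions in a state with intact input\<close>

definition env :: "ram_state \<Rightarrow> bool" where
  "env \<sigma> \<longleftrightarrow> fst \<sigma> (k + 3) = n \<and> fst \<sigma> (k + 6) = h \<and> fst \<sigma> (k + 7) = k * n * h \<and>
     (\<forall>l<k. \<forall>i<n. \<forall>q<h. snd \<sigma> ((l * n + i) * h + q) = W l i q)"

definition env' :: "ram_state \<Rightarrow> bool" where
  "env' \<sigma> \<longleftrightarrow> env \<sigma> \<and> fst \<sigma> (k + 8) = 2 ^ t \<and> fst \<sigma> (k + 9) = n ^ (k - 1)"

lemma pow_le: "l \<le> k \<Longrightarrow> n ^ l < 2 ^ w"
  using power_increasing[of l k n] n fits' by simp

lemma val_pow_exp: "env \<sigma> \<Longrightarrow> l \<le> k \<Longrightarrow> ram_val w \<sigma> (pow_exp k l) = n ^ l"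
proof (induction l)
  case (Suc l)
  then show ?case using pow_le[of "Suc l"] fits' by (simp add: env_def mult.commute)
qed (use w in simp)

lemma val_digit_exp:
  assumes "env \<sigma>" "l < k" "fst \<sigma> r < 2 ^ w"
  shows "ram_val w \<sigma> (digit_exp k r l) = digit n l (fst \<sigma> r)"
proof -
  have "fst \<sigma> r div n ^ l < 2 ^ w" using assms(3) by (meson div_le_dividend le_less_trans)
  moreover have "fst \<sigma> r div n ^ l mod n < 2 ^ w"
    using mod_less_divisor[of n "fst \<sigma> r div n ^ l"] n fits'(1) by linarith
  ultimately show ?thesis using assms fits'
    by (simp add: digit_exp_def val_pow_exp digit_def) (simp add: env_def)
qed

lemma val_row_exp:
  assumes "env \<sigma>" "l < k" "ram_val w \<sigma> i = i'" "i' < n" "ram_val w \<sigma> q = q'" "q' < h"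
  shows "ram_val w \<sigma> (row_exp k l i q) = W l i' q'"
proof -
  have "l < 2 ^ w" using assms(2) fits' by linarith
  moreover have "(l * n + i') * h + q' < 2 ^ w" using row_addr[OF assms(2,4,6)] fits' by linarith
  moreover note row_addr(2,3,4)[OF assms(2,4,6)] fits'
  moreover have "fst \<sigma> (k + 3) = n" "fst \<sigma> (k + 6) = h" "snd \<sigma> ((l * n + i') * h + q') = W l i' q'"
    using assms by (simp_all add: env_def)
  moreover note packed_word_less[of w d "U l i'" q']
  ultimately show ?thesis using assms(3,5) by (simp add: row_exp_def)
qed

lemma val_and_exp:
  assumes "env \<sigma>" "m < k" "fst \<sigma> r < 2 ^ w" "ram_val w \<sigma> q = q'" "q' < h"
  shows "ram_val w \<sigma> (and_exp k r q m) = A m (fst \<sigma> r) q'"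
  using assms(2)
proof (induction m)
  case 0
  show ?case using 0 assms digit_less[of n] n
    by (simp, intro val_row_exp val_digit_exp) auto
next
  case (Suc m)
  have "ram_val w \<sigma> (row_exp k (Suc m) (digit_exp k r (Suc m)) q) = W (Suc m) (digit n (Suc m) (fst \<sigma> r)) q'"
    using Suc.prems assms digit_less[of n] n by (intro val_row_exp val_digit_exp) auto
  then show ?case using Suc and_words_less[of n d w U "fst \<sigma> r" q' "Suc m"] by simp
qed

lemma val_entry_exp:
  assumes "env \<sigma>" "fst \<sigma> (k + 10) = v" "v < 2 ^ t" "fst \<sigma> (k + 12) = j" "j \<le> n"
  shows "ram_val w \<sigma> (entry_exp k) = k * n * h + v * (n + 1) + j"
proof -
  note entry_addr[OF assms(3,5)]
  moreover have "v < 2 ^ w" "j < 2 ^ w" using assms two_t fits' by linarith+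
  moreover have "k * n * h + v * (n + 1) < 2 ^ w" using calculation by linarith
  moreover have "fst \<sigma> (k + 3) = n" "fst \<sigma> (k + 7) = k * n * h"
    using assms by (simp_all add: env_def)
  ultimately show ?thesis using assms(2,4) fits' w by (simp add: entry_exp_def)
qed

section \<open>Initialization and the table of rows disjoint from a mask\<close>

definition bucket :: "nat \<Rightarrow> nat list" where
  "bucket v = filter (\<lambda>i. W (k - 1) i 0 AND v = 0) [0..<n]"

definition tab :: "nat \<Rightarrow> ram_state \<Rightarrow> bool" where
  "tab m \<sigma> \<longleftrightarrow> (\<forall>v<m. \<forall>j\<le>length (bucket v).
     snd \<sigma> (k * n * h + v * (n + 1) + j) = (bucket v @ [n]) ! j)"

lemma h_pos: "0 < h"
  using d w by (simp add: words_per_row_def div_greater_zero_iff)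

text \<open>The input occupies only cells below \<open>k * n * h\<close>, where the table begins, so
  writing the table does no harm.\<close>

lemma env_frame:
  "env \<sigma> \<Longrightarrow> fst \<sigma>' (k + 3) = fst \<sigma> (k + 3) \<Longrightarrow> fst \<sigma>' (k + 6) = fst \<sigma> (k + 6) \<Longrightarrow>
   fst \<sigma>' (k + 7) = fst \<sigma> (k + 7) \<Longrightarrow> (\<And>a. a < k * n * h \<Longrightarrow> snd \<sigma>' a = snd \<sigma> a) \<Longrightarrow> env \<sigma>'"
  unfolding env_def using row_addr(1) by simp

lemma env'_frame:
  "env' \<sigma> \<Longrightarrow> fst \<sigma>' (k + 3) = fst \<sigma> (k + 3) \<Longrightarrow> fst \<sigma>' (k + 6) = fst \<sigma> (k + 6) \<Longrightarrow>
   fst \<sigma>' (k + 7) = fst \<sigma> (k + 7) \<Longrightarrow> fst \<sigma>' (k + 8) = fst \<sigma> (k + 8) \<Longrightarrow>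
   fst \<sigma>' (k + 9) = fst \<sigma> (k + 9) \<Longrightarrow> (\<And>a. a < k * n * h \<Longrightarrow> snd \<sigma>' a = snd \<sigma> a) \<Longrightarrow> env' \<sigma>'"
  unfolding env'_def using env_frame[of \<sigma> \<sigma>'] by simp

lemma length_filter_upt: "length (filter P [0..<i]) \<le> i"
  using length_filter_le[of P "[0..<i]"] by simp

lemma init_prog_correct:
  "runs w (init_prog k) (prog_cost (init_prog k)) (input_state w k n d U)
     (\<lambda>\<sigma>. env \<sigma> \<and> fst \<sigma> (k + 8) = 1 \<and> fst \<sigma> (k + 4) = d)"
proof (rule runs_loop_free)
  \<comment> \<open>Subtraction is taken over the integers before reduction;
    \<open>1 \<le> d\<close> keeps the difference nonnegative.\<close>
  have [simp]: "nat ((int d + int w - 1) mod 2 ^ w) = d + w - 1"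
  proof -
    have "int d + int w - 1 = int (d + w - 1)" using d by simp
    moreover have "(d + w - 1) mod 2 ^ w = d + w - 1" using fits' by simp
    ultimately show ?thesis by (metis nat_int of_nat_mod of_nat_numeral of_nat_power)
  qed
  have [simp]: "(d + w - Suc 0) div w = h" by (simp add: words_per_row_def)
  have "input_mem w k n d U ((l * n + i) * h + q) = W l i q"
    if "l < k" "i < n" "q < h" for l i q
  proof -
    have 1: "((l * n + i) * h + q) div h = l * n + i" "((l * n + i) * h + q) mod h = q"
      using that by simp_all
    show ?thesis using row_addr(1)[OF that] that by (simp add: input_mem_def Let_def 1 del: div_mult_self1 mod_mult_self1)
  qed
  then show "env (run w (init_prog k) (input_state w k n d U)) \<and>
      fst (run w (init_prog k) (input_state w k n d U)) (k + 8) = 1 \<and>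
      fst (run w (init_prog k) (input_state w k n d U)) (k + 4) = d"
    using fits' w by (simp add: init_prog_def input_state_def env_def)
qed (auto simp: init_prog_def)

lemma double_prog_correct:
  assumes "env \<sigma>" "fst \<sigma> (k + 8) = 1"
  shows "runs w (double_prog k) ((t + 1) * 30) \<sigma> (\<lambda>\<sigma>. env \<sigma> \<and> fst \<sigma> (k + 8) = 2 ^ t)"
  unfolding double_prog_def
proof (rule runs_mono[OF runs_Loop[where N = t and c = "\<lambda>_. 10"
        and I = "\<lambda>i \<sigma>. env \<sigma> \<and> fst \<sigma> (k + 8) = 2 ^ i"]], goal_cases)
  case (2 i \<sigma>)
  have "2 ^ i * 2 \<le> (2 ^ t :: nat)"
    using power_increasing[of "Suc i" t "2::nat"] 2(1) by simp
  then have "(2 ^ i * 2) * (2 ^ i * 2) \<le> (2 ^ t * 2 ^ t :: nat)" by (intro mult_le_mono)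
  then have "4 * 2 ^ i * 2 ^ i \<le> n" using two_t(1) by linarith
  moreover have "4 * 2 ^ i * 1 \<le> (4 * 2 ^ i * 2 ^ i :: nat)" by (intro mult_le_mono2) simp
  moreover have "fst \<sigma> (k + 3) = n" "4 \<le> (4 * 2 ^ i :: nat)" using 2 by (simp_all add: env_def)
  moreover have "(2 ^ i :: nat) < 2 ^ w" "(4 * 2 ^ i :: nat) < 2 ^ w" "(4 * 2 ^ i * 2 ^ i :: nat) < 2 ^ w"
    "(4 :: nat) < 2 ^ w"
    using calculation fits' by linarith+
  ultimately show ?case using 2 fits' w
    by simp
next
  case (3 i \<sigma>)
  have "i < w" using 3(1) t_less by simp
  have "2 * 2 ^ i \<le> (2 ^ t :: nat)"
    using power_increasing[of "Suc i" t "2::nat"] 3(1) by simp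
  then have "2 * 2 ^ i < (2 ^ w :: nat)" using two_t(3) fits' by linarith
  with 3 \<open>i < w\<close> show ?case
    using fits' by (intro runs_loop_free) (auto intro: env_frame)
next
  case (4 \<sigma>)
  \<comment> \<open>The failing test computes \<open>4 ^ (t + 1)\<close>, which exceeds
    \<open>n\<close>; the factor 4 in \<open>fits\<close> makes room for it.\<close>
  have "(4 * 2 ^ t) * 2 ^ t \<le> (4 * (n + 1)) * (n + 1)"
    using two_t(3) by (intro mult_le_mono) auto
  then have "4 * 2 ^ t * 2 ^ t < (2 ^ w :: nat)" using fits' by linarith
  moreover have "4 * 2 ^ t * 1 \<le> (4 * 2 ^ t * 2 ^ t :: nat)" by (intro mult_le_mono2) simp
  moreover have "4 \<le> (4 * 2 ^ t :: nat)" by simp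
  moreover have "fst \<sigma> (k + 3) = n" using 4 by (simp add: env_def)
  moreover have "(2 ^ t :: nat) < 2 ^ w" "(4 * 2 ^ t :: nat) < 2 ^ w" "(4 :: nat) < 2 ^ w"
    using calculation fits' by linarith+
  ultimately show ?case using 4 two_t(2) fits' w by simp
qed (use assms in auto)

lemma setup_prog_correct:
  assumes "env \<sigma>" "fst \<sigma> (k + 8) = 2 ^ t"
  shows "runs w (setup_prog k) (prog_cost (setup_prog k)) \<sigma>
    (\<lambda>\<sigma>. env' \<sigma> \<and> fst \<sigma> (k + 10) = 0 \<and> fst \<sigma> (k + 13) = 0 \<and> fst \<sigma> (k + 16) = 0)"
  using assms val_pow_exp[OF assms(1), of "k - 1"]
  by (intro runs_loop_free) (auto simp: setup_prog_def env'_def intro: env_frame)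

definition fill_inv :: "nat \<Rightarrow> nat \<Rightarrow> ram_state \<Rightarrow> bool" where
  "fill_inv m i \<sigma> \<longleftrightarrow> env' \<sigma> \<and> fst \<sigma> (k + 13) = 0 \<and> fst \<sigma> (k + 16) = 0 \<and> tab m \<sigma> \<and>
     fst \<sigma> (k + 10) = m \<and> fst \<sigma> (k + 11) = i \<and>
     (let xs = filter (\<lambda>i. W (k - 1) i 0 AND m = 0) [0..<i]
      in fst \<sigma> (k + 12) = length xs \<and>
         (\<forall>j<length xs. snd \<sigma> (k * n * h + m * (n + 1) + j) = xs ! j))"

text \<open>A list with its sentinel takes at most \<open>n + 1\<close> cells, so the lists of
  smaller masks end before the list of mask \<open>m\<close> begins.\<close>

lemma tab_frame:
  assumes "tab m \<sigma>" "\<And>a. a < k * n * h + m * (n + 1) \<Longrightarrow> snd \<sigma>' a = snd \<sigma> a"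
  shows "tab m \<sigma>'"
  unfolding tab_def
proof (intro allI impI)
  fix v j assume v: "v < m" and j: "j \<le> length (bucket v)"
  have "j \<le> n" using j length_filter_upt[of _ n] unfolding bucket_def by (meson le_trans)
  then have "v * (n + 1) + j < (v + 1) * (n + 1)" by simp
  also have "\<dots> \<le> m * (n + 1)" using v by (intro mult_le_mono) auto
  finally show "snd \<sigma>' (k * n * h + v * (n + 1) + j) = (bucket v @ [n]) ! j"
    using assms v j by (simp add: tab_def)
qed

lemma fill_step_correct:
  assumes "i < n" "m < 2 ^ t" "fill_inv m i \<sigma>"
  shows "fill_inv m (Suc i) (run w (fill_step k) \<sigma>)"
proof -
  define xs where "xs = filter (\<lambda>i. W (k - 1) i 0 AND m = 0) [0..<i]"
  have inv: "env' \<sigma>" "fst \<sigma> (k + 13) = 0" "fst \<sigma> (k + 16) = 0" "tab m \<sigma>"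
     "fst \<sigma> (k + 10) = m" "fst \<sigma> (k + 11) = i" "fst \<sigma> (k + 12) = length xs"
     "\<And>j. j < length xs \<Longrightarrow> snd \<sigma> (k * n * h + m * (n + 1) + j) = xs ! j"
    using assms(3) by (auto simp: fill_inv_def xs_def Let_def)
  have env: "env \<sigma>" using inv(1) by (simp add: env'_def)
  have len: "length xs \<le> n" using length_filter_upt[of _ i] assms(1) unfolding xs_def
    by (meson le_trans less_imp_le)
  have bounds: "i < 2 ^ w" "m < 2 ^ w" "Suc i < 2 ^ w" "Suc (length xs) < 2 ^ w" "0 < w"
    using assms(1,2) two_t fits' len w by linarith+
  have row: "ram_val w \<sigma> (row_exp k (k - 1) (Reg (k + 11)) (Lit 0)) = W (k - 1) i 0"
    using val_row_exp[OF env, of "k - 1" "Reg (k + 11)" i "Lit 0" 0] inv(6) bounds k assms(1) h_pos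
    by simp
  have entry: "ram_val w \<sigma> (entry_exp k) = k * n * h + m * (n + 1) + length xs"
    by (rule val_entry_exp[OF env inv(5) assms(2) inv(7) len])
  have lt: "(W (k - 1) i 0 AND m) < 2 ^ w"
    using le_less_trans[OF and_le_left packed_word_less] .
  show ?thesis
  proof (cases "W (k - 1) i 0 AND m = 0")
    case True
    have xs': "filter (\<lambda>i. W (k - 1) i 0 AND m = 0) [0..<Suc i] = xs @ [i]"
      using True by (simp add: xs_def)
    have run: "run w (fill_step k) \<sigma> =
        ((fst \<sigma>)(k + 12 := Suc (length xs), k + 11 := Suc i),
         (snd \<sigma>)(k * n * h + m * (n + 1) + length xs := i))"
      using True row entry inv(5-7) bounds by (simp add: fill_step_def incr_def)
    show ?thesis
      unfolding fill_inv_def xs' run Let_def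
      using inv by (auto simp: nth_append less_Suc_eq intro: env'_frame tab_frame)
  next
    case False
    have xs': "filter (\<lambda>i. W (k - 1) i 0 AND m = 0) [0..<Suc i] = xs"
      using False by (simp add: xs_def)
    have run: "run w (fill_step k) \<sigma> = ((fst \<sigma>)(k + 11 := Suc i), snd \<sigma>)"
      using False row lt inv(5-7) bounds by (simp add: fill_step_def incr_def)
    show ?thesis
      unfolding fill_inv_def xs' run Let_def
      using inv by (auto intro: env'_frame tab_frame)
  qed
qed

definition table_inv :: "nat \<Rightarrow> ram_state \<Rightarrow> bool" where
  "table_inv m \<sigma> \<longleftrightarrow> env' \<sigma> \<and> fst \<sigma> (k + 13) = 0 \<and> fst \<sigma> (k + 16) = 0 \<and> tab m \<sigma> \<and>
     fst \<sigma> (k + 10) = m"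

lemma fill_end_correct:
  assumes "m < 2 ^ t" "fill_inv m n \<sigma>"
  shows "table_inv (Suc m) (run w (fill_end k) \<sigma>)"
proof -
  have inv: "env' \<sigma>" "fst \<sigma> (k + 13) = 0" "fst \<sigma> (k + 16) = 0" "tab m \<sigma>"
     "fst \<sigma> (k + 10) = m" "fst \<sigma> (k + 11) = n" "fst \<sigma> (k + 12) = length (bucket m)"
     "\<And>j. j < length (bucket m) \<Longrightarrow> snd \<sigma> (k * n * h + m * (n + 1) + j) = bucket m ! j"
    using assms(2) by (auto simp: fill_inv_def bucket_def Let_def)
  have env: "env \<sigma>" and n': "fst \<sigma> (k + 3) = n" using inv(1) by (simp_all add: env'_def env_def)
  have len: "length (bucket m) \<le> n" using length_filter_upt[of _ n] unfolding bucket_def by simp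
  have bounds: "Suc m < 2 ^ w" "0 < w"
    using assms(1) two_t fits' w by linarith+
  have entry: "ram_val w \<sigma> (entry_exp k) = k * n * h + m * (n + 1) + length (bucket m)"
    by (rule val_entry_exp[OF env inv(5) assms(1) inv(7) len])
  have run: "run w (fill_end k) \<sigma> =
      ((fst \<sigma>)(k + 10 := Suc m), (snd \<sigma>)(k * n * h + m * (n + 1) + length (bucket m) := n))"
    using entry inv(5) n' bounds fits' by (simp add: fill_end_def incr_def)
  have "tab m (run w (fill_end k) \<sigma>)" using inv(4) unfolding run by (rule tab_frame) auto
  then have "tab (Suc m) (run w (fill_end k) \<sigma>)"
    using inv(8) unfolding tab_def run by (auto simp: less_Suc_eq nth_append le_less)
  moreover have "env' (run w (fill_end k) \<sigma>)"
    using inv(1) unfolding run by (rule env'_frame) simp_all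
  ultimately show ?thesis
    unfolding table_inv_def using inv(2,3) by (simp add: run)
qed

lemma table_prog_correct:
  assumes "table_inv 0 \<sigma>"
  shows "runs w (table_prog k) (2 ^ t * (n + 1) * fill_cost k + (2 ^ t + 1) * 4) \<sigma> (table_inv (2 ^ t))"
  unfolding table_prog_def
proof (rule runs_mono[OF runs_Loop[where N = "2 ^ t" and c = "\<lambda>_. (n + 1) * fill_cost k" and I = table_inv]],
    goal_cases)
  case (2 i \<sigma>)
  then show ?case using two_t(3) fits' w t_less by (simp add: table_inv_def env'_def)
next
  case (3 m \<sigma>)
  have start: "fill_inv m 0 (run w (fill_init k) \<sigma>)"
    using 3(2) by (auto simp: fill_init_def fill_inv_def table_inv_def intro: env'_frame tab_frame)
  have loop: "runs w (Loop (Bin Less (Reg (k + 11)) (Reg (k + 3))) (fill_step k))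
      (n * prog_cost (fill_step k) + (n + 1) * 4) \<sigma>' (fill_inv m n)" if "fill_inv m 0 \<sigma>'" for \<sigma>'
  proof (rule runs_mono[OF runs_Loop[where N = n and c = "\<lambda>_. prog_cost (fill_step k)" and I = "fill_inv m"]],
      goal_cases)
    case (2 i \<sigma>)
    then show ?case using fits' w by (simp add: fill_inv_def env'_def env_def)
  next
    case (3 i \<sigma>)
    show ?case
    proof (rule runs_loop_free)
      show "fill_inv m (Suc i) (run w (fill_step k) \<sigma>)"
        by (rule fill_step_correct[OF 3(1) \<open>m < 2 ^ t\<close> 3(2)])
    qed (simp_all add: fill_step_def incr_def)
  next
    case (4 \<sigma>)
    then show ?case using fits' w by (simp add: fill_inv_def env'_def env_def)
  qed (use that in auto)
  have "runs w (Then (fill_init k) (Then (Loop (Bin Less (Reg (k + 11)) (Reg (k + 3))) (fill_step k)) (fill_end k)))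
     (prog_cost (fill_init k) + ((n * prog_cost (fill_step k) + (n + 1) * 4) + prog_cost (fill_end k))) \<sigma> (table_inv (Suc m))"
    apply (rule runs_Then, rule runs_loop_free[OF _ _ order_refl])
     apply (simp add: fill_init_def)
    apply (rule runs_Then, rule runs_mono[OF loop[OF start] order_refl])
    apply (rule runs_loop_free[OF _ _ order_refl])
     apply (simp add: fill_end_def incr_def)
    apply (erule fill_end_correct[OF 3(1)])
    done
  then show ?case
    by (rule runs_mono) (auto simp: fill_cost_def algebra_simps)
next
  case (4 \<sigma>)
  then show ?case using two_t(3) fits' w t_less by (simp add: table_inv_def env'_def)
qed (use assms in \<open>auto simp: algebra_simps\<close>)

section \<open>The search through all tuples\<close>

definition full :: "nat \<Rightarrow> bool" where
  "full y \<longleftrightarrow> y < n ^ k \<and> (\<forall>q<h. A (k - 1) y q = 0)"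

text \<open>The number of iterations of the scanning loop. The disjunct \<open>q = h\<close>
  guarantees existence and is attained when every word is zero.\<close>

definition scan :: "nat \<Rightarrow> nat" where
  "scan y = (LEAST q. q = h \<or> A (k - 1) y q \<noteq> 0)"

definition mask :: "nat \<Rightarrow> nat" where
  "mask x = A (k - 2) x 0 mod 2 ^ t"

lemma scan_le: "scan y \<le> h"
  unfolding scan_def by (rule Least_le) simp

lemma scan_end_cases: "scan y = h \<or> A (k - 1) y (scan y) \<noteq> 0"
  unfolding scan_def by (rule LeastI[of _ h]) simp

lemma zero_if_less_scan: "q < scan y \<Longrightarrow> A (k - 1) y q = 0"
  using not_less_Least[of q "\<lambda>q. q = h \<or> A (k - 1) y q \<noteq> 0"] by (auto simp: scan_def)

lemma full_iff_scan: "full y \<longleftrightarrow> y < n ^ k \<and> scan y = h"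
  unfolding full_def using scan_le[of y] scan_end_cases[of y] zero_if_less_scan[of _ y]
  by (metis le_neq_implies_less)

lemma mask_less: "mask x < 2 ^ t"
  by (simp add: mask_def)

lemma bucket_nth: "j < length (bucket v) \<Longrightarrow> bucket v ! j < n"
  using nth_mem[of j "bucket v"] by (auto simp: bucket_def)

lemma length_bucket: "length (bucket v) \<le> n"
  using length_filter_upt[of _ n] by (simp add: bucket_def)

lemma tuple_less:
  assumes "x < n ^ (k - 1)" "i < n"
  shows "x + i * n ^ (k - 1) < n ^ k"
proof -
  have "x + i * n ^ (k - 1) < (i + 1) * n ^ (k - 1)" using assms by simp
  also have "\<dots> \<le> n * n ^ (k - 1)" using assms by (intro mult_le_mono) auto
  also have "\<dots> = n ^ k" using k by (simp flip: power_Suc)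
  finally show ?thesis .
qed

definition search_env :: "ram_state \<Rightarrow> bool" where
  "search_env \<sigma> \<longleftrightarrow> env' \<sigma> \<and> tab (2 ^ t) \<sigma> \<and> fst \<sigma> (k + 16) < n ^ k"

text \<open>Records that some candidate examined so far is a solution, without naming it. Since
  successes overwrite each other, the invariants only claim that the answer register then holds some
  solution.\<close>

definition found :: "nat \<Rightarrow> bool" where
  "found x \<longleftrightarrow> (\<exists>x'<x. \<exists>i\<in>set (bucket (mask x')). full (x' + i * n ^ (k - 1)))"

definition search_inv :: "nat \<Rightarrow> ram_state \<Rightarrow> bool" where
  "search_inv x \<sigma> \<longleftrightarrow> search_env \<sigma> \<and> fst \<sigma> (k + 13) = x \<and> (found x \<longrightarrow> full (fst \<sigma> (k + 16)))"

definition bucket_inv :: "nat \<Rightarrow> nat \<Rightarrow> ram_state \<Rightarrow> bool" where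
  "bucket_inv x j \<sigma> \<longleftrightarrow> search_env \<sigma> \<and> fst \<sigma> (k + 13) = x \<and> fst \<sigma> (k + 10) = mask x \<and> fst \<sigma> (k + 12) = j \<and>
     (found x \<or> (\<exists>j'<j. full (x + bucket (mask x) ! j' * n ^ (k - 1))) \<longrightarrow> full (fst \<sigma> (k + 16)))"

definition scan_inv :: "nat \<Rightarrow> nat \<Rightarrow> nat \<Rightarrow> ram_state \<Rightarrow> bool" where
  "scan_inv x j q \<sigma> \<longleftrightarrow> bucket_inv x j \<sigma> \<and> fst \<sigma> (k + 15) = q \<and>
     fst \<sigma> (k + 14) = x + bucket (mask x) ! j * n ^ (k - 1)"

lemma search_env_frame:
  "search_env \<sigma> \<Longrightarrow> fst \<sigma>' (k + 3) = fst \<sigma> (k + 3) \<Longrightarrow> fst \<sigma>' (k + 6) = fst \<sigma> (k + 6) \<Longrightarrow>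
   fst \<sigma>' (k + 7) = fst \<sigma> (k + 7) \<Longrightarrow> fst \<sigma>' (k + 8) = fst \<sigma> (k + 8) \<Longrightarrow>
   fst \<sigma>' (k + 9) = fst \<sigma> (k + 9) \<Longrightarrow> fst \<sigma>' (k + 16) < n ^ k \<Longrightarrow> snd \<sigma>' = snd \<sigma> \<Longrightarrow> search_env \<sigma>'"
  unfolding search_env_def using env'_frame[of \<sigma> \<sigma>'] by (simp add: tab_def)

lemma val_entry:
  assumes "bucket_inv x j \<sigma>" "j \<le> length (bucket (mask x))"
  shows "ram_val w \<sigma> (Load (entry_exp k)) = (bucket (mask x) @ [n]) ! j"
proof -
  have "env \<sigma>" "fst \<sigma> (k + 10) = mask x" "fst \<sigma> (k + 12) = j" and tab: "tab (2 ^ t) \<sigma>"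
    using assms(1) by (simp_all add: bucket_inv_def search_env_def env'_def)
  then have "ram_val w \<sigma> (entry_exp k) = k * n * h + mask x * (n + 1) + j"
    using val_entry_exp[of \<sigma> "mask x" j] mask_less[of x] assms(2) length_bucket[of "mask x"] by simp
  moreover have "snd \<sigma> (k * n * h + mask x * (n + 1) + j) = (bucket (mask x) @ [n]) ! j"
    using tab mask_less[of x] assms(2) by (simp add: tab_def)
  moreover have "(bucket (mask x) @ [n]) ! j \<le> n"
    using bucket_nth[of j "mask x"] assms(2) by (auto simp: nth_append)
  ultimately show ?thesis using fits'(1) by simp
qed

lemma tuple_bound: "1 \<le> n ^ (k - 1)" "n ^ (k - 1) < 2 ^ w"
  using n pow_le[of "k - 1"] by simp_all

lemma scan_init_correct:
  assumes "bucket_inv x j \<sigma>" "j < length (bucket (mask x))" "x < n ^ (k - 1)"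
  shows "scan_inv x j 0 (run w (scan_init k) \<sigma>)"
proof -
  let ?i = "bucket (mask x) ! j"
  have i: "?i < n" using assms(2) by (rule bucket_nth)
  have "x + ?i * n ^ (k - 1) < 2 ^ w"
    using tuple_less[OF assms(3) i] fits'(9) by linarith
  moreover have "?i * n ^ (k - 1) < 2 ^ w" "x < 2 ^ w" using calculation by linarith+
  moreover have "ram_val w \<sigma> (Load (entry_exp k)) = ?i"
    using val_entry[OF assms(1)] assms(2) by (simp add: nth_append)
  moreover have "fst \<sigma> (k + 13) = x" "fst \<sigma> (k + 9) = n ^ (k - 1)"
    using assms(1) by (simp_all add: bucket_inv_def search_env_def env'_def)
  ultimately have run: "run w (scan_init k) \<sigma> =
      ((fst \<sigma>)(k + 14 := x + ?i * n ^ (k - 1), k + 15 := 0), snd \<sigma>)"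
    using tuple_bound w by (simp add: scan_init_def del: ram_val.simps(3))
  have "search_env \<sigma>" using assms(1) by (simp add: bucket_inv_def)
  then have "search_env (run w (scan_init k) \<sigma>)"
    unfolding run by (rule search_env_frame) (simp_all add: \<open>search_env \<sigma>\<close>[unfolded search_env_def])
  then show ?thesis using assms(1) by (simp add: scan_inv_def bucket_inv_def run)
qed

lemma scan_end_correct:
  assumes "scan_inv x j (scan (x + bucket (mask x) ! j * n ^ (k - 1))) \<sigma>"
    "j < length (bucket (mask x))" "x < n ^ (k - 1)"
  shows "bucket_inv x (Suc j) (run w (scan_end k) \<sigma>)"
proof -
  let ?y = "x + bucket (mask x) ! j * n ^ (k - 1)"
  have y: "?y < n ^ k" using tuple_less[OF assms(3) bucket_nth[OF assms(2)]] .
  have inv: "search_env \<sigma>" "fst \<sigma> (k + 13) = x" "fst \<sigma> (k + 10) = mask x" "fst \<sigma> (k + 12) = j"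
    "fst \<sigma> (k + 15) = scan ?y" "fst \<sigma> (k + 14) = ?y"
    "found x \<or> (\<exists>j'<j. full (x + bucket (mask x) ! j' * n ^ (k - 1))) \<Longrightarrow> full (fst \<sigma> (k + 16))"
    using assms(1) by (auto simp: scan_inv_def bucket_inv_def)
  have h: "fst \<sigma> (k + 6) = h" using inv(1) by (simp add: search_env_def env'_def env_def)
  have "?y < 2 ^ w" "Suc j < 2 ^ w" "scan ?y < 2 ^ w" "0 < w"
    using y assms(2) length_bucket[of "mask x"] fits' scan_le[of ?y] w by linarith+
  then have run: "run w (scan_end k) \<sigma> = (let r = (if scan ?y = h then (fst \<sigma>)(k + 16 := ?y) else fst \<sigma>)
      in (r(k + 12 := Suc j), snd \<sigma>))"
    using inv(4-6) h fits'(3) by (simp add: scan_end_def incr_def Let_def)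
  have "search_env (run w (scan_end k) \<sigma>)"
    using inv(1) unfolding run Let_def
    by (rule search_env_frame) (use inv(1) y in \<open>auto simp: search_env_def\<close>)
  then show ?thesis
    using inv y full_iff_scan[of ?y] unfolding bucket_inv_def run Let_def
    by (auto simp: less_Suc_eq)
qed

lemma bucket_step_correct:
  assumes "bucket_inv x j \<sigma>" "j < length (bucket (mask x))" "x < n ^ (k - 1)"
  shows "runs w (bucket_step k)
    (scan_cost k * (1 + scan (x + bucket (mask x) ! j * n ^ (k - 1)))) \<sigma> (bucket_inv x (Suc j))"
proof -
  let ?y = "x + bucket (mask x) ! j * n ^ (k - 1)"
  have y: "?y < 2 ^ w" using tuple_less[OF assms(3) bucket_nth[OF assms(2)]] fits'(9) by linarith
  have test: "ram_val w \<sigma> (scan_test k) \<noteq> 0 \<longleftrightarrow> q < h \<and> A (k - 1) ?y q = 0"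
    if "scan_inv x j q \<sigma>" "q \<le> h" for q \<sigma>
  proof -
    have q: "q < 2 ^ w" using that(2) fits'(3) by linarith
    have *: "env \<sigma>" "fst \<sigma> (k + 14) = ?y" "fst \<sigma> (k + 15) = q" "fst \<sigma> (k + 6) = h"
      using that by (simp_all add: scan_inv_def bucket_inv_def search_env_def env'_def env_def)
    have "ram_val w \<sigma> (and_exp k (k + 14) (Reg (k + 15)) (k - 1)) = A (k - 1) ?y q" if "q < h"
      using val_and_exp[OF *(1), of "k - 1" "k + 14" "Reg (k + 15)" q] *(2,3) y q that k by simp
    then show ?thesis using * q w fits'(3) and_words_less[of n d w U ?y q "k - 1"]
      by (cases "q < h") (simp_all add: scan_test_def)
  qed
  have loop: "runs w (Loop (scan_test k) (incr (k + 15)))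
      (scan ?y * 4 + (scan ?y + 1) * (1 + ram_cost (scan_test k))) \<sigma>' (scan_inv x j (scan ?y))"
    if "scan_inv x j 0 \<sigma>'" for \<sigma>'
  \<comment> \<open>As the loop rule is used with exactly \<open>scan ?y\<close> iterations, the
    vanishing of the words already passed comes from the definition of \<open>scan\<close> and stays
    out of \<open>scan_inv\<close>.\<close>
  proof (rule runs_mono[OF runs_Loop[where N = "scan ?y" and c = "\<lambda>_. 4" and I = "scan_inv x j"]],
      goal_cases)
    case (2 q \<sigma>)
    then show ?case using test[OF 2(2)] zero_if_less_scan[OF 2(1)] scan_le[of ?y] by simp
  next
    case (3 q \<sigma>)
    have "Suc q < 2 ^ w" "0 < w" using 3(1) scan_le[of ?y] fits'(3) w by linarith+
    then have run: "run w (incr (k + 15)) \<sigma> = ((fst \<sigma>)(k + 15 := Suc q), snd \<sigma>)"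
      using 3(2) by (simp add: incr_def scan_inv_def)
    have env: "search_env \<sigma>" using 3(2) by (simp add: scan_inv_def bucket_inv_def)
    then have "search_env (run w (incr (k + 15)) \<sigma>)" unfolding run
      by (rule search_env_frame) (simp_all add: env[unfolded search_env_def])
    then have "scan_inv x j (Suc q) (run w (incr (k + 15)) \<sigma>)"
      using 3(2) by (simp add: scan_inv_def bucket_inv_def run)
    then show ?case by (rule runs_loop_free[rotated]) (simp_all add: incr_def)
  next
    case (4 \<sigma>)
    then show ?case using test[OF 4 scan_le] scan_end_cases[of ?y] by auto
  qed (use that in auto)
  have "runs w (bucket_step k)
     (prog_cost (scan_init k) + ((scan ?y * 4 + (scan ?y + 1) * (1 + ram_cost (scan_test k))) +
      prog_cost (scan_end k))) \<sigma> (bucket_inv x (Suc j))"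
    unfolding bucket_step_def
    apply (rule runs_Then, rule runs_loop_free[OF _ _ order_refl])
     apply (simp add: scan_init_def)
    apply (rule runs_Then, rule runs_mono[OF loop[OF scan_init_correct[OF assms]] order_refl])
    apply (rule runs_loop_free[OF _ _ order_refl])
     apply (simp add: scan_end_def incr_def)
    apply (erule scan_end_correct[OF _ assms(2,3)])
    done
  then show ?thesis
    by (rule runs_mono) (simp_all add: scan_cost_def algebra_simps)
qed

lemma bucket_init_correct:
  assumes "search_inv x \<sigma>" "x < n ^ (k - 1)"
  shows "bucket_inv x 0 (run w (bucket_init k) \<sigma>)"
proof -
  have *: "search_env \<sigma>" "env \<sigma>" "fst \<sigma> (k + 13) = x" "fst \<sigma> (k + 8) = 2 ^ t"
    using assms(1) by (simp_all add: search_inv_def search_env_def env'_def)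
  have "x < 2 ^ w" using assms(2) tuple_bound by linarith
  then have "ram_val w \<sigma> (and_exp k (k + 13) (Lit 0) (k - 2)) = A (k - 2) x 0"
    using val_and_exp[OF *(2), of "k - 2" "k + 13" "Lit 0" 0] *(3) k h_pos by simp
  moreover have "mask x < 2 ^ w" using mask_less[of x] two_t(3) fits'(1) by linarith
  ultimately have run: "run w (bucket_init k) \<sigma> = ((fst \<sigma>)(k + 10 := mask x, k + 12 := 0), snd \<sigma>)"
    using *(4) t_less by (simp add: bucket_init_def mask_def)
  have "search_env (run w (bucket_init k) \<sigma>)"
    using *(1) unfolding run by (rule search_env_frame) (simp_all add: *(1)[unfolded search_env_def])
  then show ?thesis using assms(1) by (simp add: bucket_inv_def search_inv_def run)
qed

lemma bucket_end_correct:
  assumes "bucket_inv x (length (bucket (mask x))) \<sigma>" "x < n ^ (k - 1)"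
  shows "search_inv (Suc x) (run w (incr (k + 13)) \<sigma>)"
proof -
  have *: "search_env \<sigma>" "fst \<sigma> (k + 13) = x"
    using assms(1) by (simp_all add: bucket_inv_def)
  have "Suc x < 2 ^ w" "0 < w" using assms(2) tuple_bound w by linarith+
  then have run: "run w (incr (k + 13)) \<sigma> = ((fst \<sigma>)(k + 13 := Suc x), snd \<sigma>)"
    using *(2) by (simp add: incr_def)
  have "search_env (run w (incr (k + 13)) \<sigma>)"
    using *(1) unfolding run by (rule search_env_frame) (simp_all add: *(1)[unfolded search_env_def])
  then show ?thesis using assms(1)
    by (auto simp: bucket_inv_def search_inv_def run found_def less_Suc_eq in_set_conv_nth)
qed

lemma search_prog_correct:
  assumes "search_inv 0 \<sigma>"
  shows "runs w (search_prog k)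
    ((\<Sum>x<n ^ (k - 1). bucket_cost k + (\<Sum>i\<leftarrow>bucket (mask x).
        (scan_cost k + bucket_cost k) * (1 + scan (x + i * n ^ (k - 1))))) + (n ^ (k - 1) + 1) * 4)
    \<sigma> (search_inv (n ^ (k - 1)))"
  unfolding search_prog_def
proof (rule runs_mono[OF runs_Loop[where N = "n ^ (k - 1)" and I = search_inv and
      c = "\<lambda>x. bucket_cost k + (\<Sum>i\<leftarrow>bucket (mask x).
        (scan_cost k + bucket_cost k) * (1 + scan (x + i * n ^ (k - 1))))"]], goal_cases)
  case (2 x \<sigma>)
  then show ?case using tuple_bound w by (simp add: search_inv_def search_env_def env'_def)
next
  case (3 x \<sigma>)
  let ?c = "\<lambda>j. scan_cost k * (1 + scan (x + bucket (mask x) ! j * n ^ (k - 1)))"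
  let ?l = "length (bucket (mask x))"
  have test: "ram_val w \<sigma> (bucket_test k) \<noteq> 0 \<longleftrightarrow> j < ?l" if "bucket_inv x j \<sigma>" "j \<le> ?l" for j \<sigma>
  proof -
    have "fst \<sigma> (k + 3) = n"
      using that(1) by (simp add: bucket_inv_def search_env_def env'_def env_def)
    then show ?thesis using val_entry[OF that] that(2) fits'(1) w bucket_nth[of j "mask x"]
      by (auto simp: bucket_test_def nth_append simp del: ram_val.simps(3))
  qed
  have loop: "runs w (Loop (bucket_test k) (bucket_step k))
      ((\<Sum>j<?l. ?c j) + (?l + 1) * (1 + ram_cost (bucket_test k))) \<sigma>' (bucket_inv x ?l)"
    if "bucket_inv x 0 \<sigma>'" for \<sigma>'
    by (rule runs_Loop[where I = "bucket_inv x"])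
      (use that test 3(1) bucket_step_correct in auto)
  have "runs w (Then (bucket_init k) (Then (Loop (bucket_test k) (bucket_step k)) (incr (k + 13))))
     (prog_cost (bucket_init k) + (((\<Sum>j<?l. ?c j) + (?l + 1) * (1 + ram_cost (bucket_test k))) + 4))
     \<sigma> (search_inv (Suc x))"
    apply (rule runs_Then, rule runs_loop_free[OF _ _ order_refl])
     apply (simp add: bucket_init_def)
    apply (rule runs_Then, rule runs_mono[OF loop[OF bucket_init_correct[OF 3(2,1)]] order_refl])
    apply (rule runs_loop_free)
      apply (simp add: incr_def)
     apply (erule bucket_end_correct[OF _ 3(1)])
    apply (simp add: incr_def)
    done
  then show ?case
  proof (rule runs_mono)
    have "(\<Sum>i\<leftarrow>bucket (mask x). (scan_cost k + bucket_cost k) * (1 + scan (x + i * n ^ (k - 1)))) =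
       (\<Sum>j<?l. (scan_cost k + bucket_cost k) * (1 + scan (x + bucket (mask x) ! j * n ^ (k - 1))))"
      by (simp add: sum_list_sum_nth lessThan_atLeast0)
    moreover have "(\<Sum>j<?l. ?c j + bucket_cost k) \<le> \<dots>"
      by (intro sum_mono) (simp add: algebra_simps)
    moreover have "(\<Sum>j<?l. ?c j + bucket_cost k) = (\<Sum>j<?l. ?c j) + ?l * bucket_cost k"
      by (simp add: sum.distrib)
    \<comment> \<open>Each successful list test is charged to the \<open>bucket_cost k\<close> in
      the summand of its candidate, the failing one at the sentinel to the
      \<open>bucket_cost k\<close> in front.\<close>
    moreover have "?l * (1 + ram_cost (bucket_test k)) \<le> ?l * bucket_cost k"
      by (intro mult_le_mono2) (simp add: bucket_cost_def)
    ultimately show "prog_cost (bucket_init k) + (((\<Sum>j<?l. ?c j) + (?l + 1) * (1 + ram_cost (bucket_test k))) + 4)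
      \<le> bucket_cost k + (\<Sum>i\<leftarrow>bucket (mask x). (scan_cost k + bucket_cost k) * (1 + scan (x + i * n ^ (k - 1))))"
      unfolding bucket_cost_def by (simp add: add_mult_distrib)
  qed
next
  case (4 \<sigma>)
  then show ?case using tuple_bound w by (simp add: search_inv_def search_env_def env'_def)
qed (use assms in auto)

lemma output_prog_correct:
  assumes "env \<sigma>" "fst \<sigma> (k + 16) < n ^ k" "m \<le> k"
  shows "runs w (output_prog k m) (prog_cost (output_prog k m)) \<sigma>
    (\<lambda>\<sigma>'. \<forall>l<m. fst \<sigma>' l = digit n l (fst \<sigma> (k + 16)))"
proof (rule runs_loop_free)
  show "loop_free (output_prog k m)" by (induction m) auto
  have "env (run w (output_prog k m) \<sigma>) \<and> fst (run w (output_prog k m) \<sigma>) (k + 16) = fst \<sigma> (k + 16) \<and>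
    (\<forall>l<m. fst (run w (output_prog k m) \<sigma>) l = digit n l (fst \<sigma> (k + 16)))"
    using assms(3)
  proof (induction m)
    case (Suc m)
    define \<sigma>' where "\<sigma>' = run w (output_prog k m) \<sigma>"
    have IH: "env \<sigma>'" "fst \<sigma>' (k + 16) = fst \<sigma> (k + 16)"
      "\<And>l. l < m \<Longrightarrow> fst \<sigma>' l = digit n l (fst \<sigma> (k + 16))" using Suc by (auto simp: \<sigma>'_def)
    have run: "run w (output_prog k (Suc m)) \<sigma> = ((fst \<sigma>')(m := digit n m (fst \<sigma> (k + 16))), snd \<sigma>')"
      using val_digit_exp[OF IH(1), of m "k + 16"] Suc.prems assms(2) fits'(9) IH(2)
      by (simp add: \<sigma>'_def)
    have "env (run w (output_prog k (Suc m)) \<sigma>)"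
      using IH(1) unfolding run by (rule env_frame) (use Suc.prems in simp_all)
    then show ?case unfolding run using IH(2,3) Suc.prems by (auto simp: less_Suc_eq)
  qed (use assms in auto)
  then show "\<forall>l<m. fst (run w (output_prog k m) \<sigma>) l = digit n l (fst \<sigma> (k + 16))" by blast
qed simp

section \<open>Zero words as orthogonality, and the total cost of the search\<close>

lemma le_pred_iff: "l \<le> k - Suc 0 \<longleftrightarrow> l < k"
  using k by auto

text \<open>Coordinate \<open>j\<close> is bit \<open>j mod w\<close> of word
  \<open>j div w\<close>, and that bit of the conjunction is set only if all \<open>k\<close> rows
  have a one there.\<close>

lemma orth_if_words_zero:
  assumes "\<And>q'. q' < q \<Longrightarrow> A (k - 1) y q' = 0" "q * w \<le> d \<or> q = h" "j < q * w" "j < d"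
  shows "\<exists>l<k. \<not> U l (digit n l y) j"
proof -
  have "j div w < q" using assms(3) w by (simp add: div_less_iff_less_mult)
  then have "\<not> bit (A (k - 1) y (j div w)) (j mod w)" using assms(1) by simp
  then show ?thesis using w assms(4) by (auto simp: bit_and_words le_pred_iff)
qed

lemma d_le: "d \<le> h * w"
proof -
  have "d + w - 1 = h * w + (d + w - 1) mod w" by (simp add: words_per_row_def)
  then show ?thesis using w mod_less_divisor[of w "d + w - 1"] by linarith
qed

text \<open>Padding bits are never set in a packed word, so testing whole words tests exactly the
  \<open>d\<close> coordinates.\<close>

lemma full_iff: "full y \<longleftrightarrow> y < n ^ k \<and> orthogonal_vecs k d (\<lambda>l. U l (digit n l y))"
proof -
  have "(\<forall>q<h. A (k - 1) y q = 0) \<longleftrightarrow> (\<forall>j<d. \<exists>l<k. \<not> U l (digit n l y) j)"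
  proof safe
    fix j assume "\<forall>q<h. A (k - 1) y q = 0" "j < d"
    then show "\<exists>l<k. \<not> U l (digit n l y) j"
      using orth_if_words_zero[of h y j] d_le by auto
  next
    fix q assume "\<forall>j<d. \<exists>l<k. \<not> U l (digit n l y) j"
    then have "\<not> bit (A (k - 1) y q) b" for b
      by (auto simp: bit_and_words le_pred_iff)
    then show "A (k - 1) y q = 0" by (intro bit_eqI) simp
  qed
  then show ?thesis by (simp add: full_def orthogonal_vecs_iff)
qed

text \<open>Truncating one factor of a conjunction truncates the result. Hence the lookup by mask
  keeps exactly the tuples whose conjunction vanishes on its first \<open>t\<close> bits.\<close>

lemma candidate_iff:
  assumes "x < n ^ (k - 1)" "i < n"
  shows "W (k - 1) i 0 AND mask x = A (k - 1) (x + i * n ^ (k - 1)) 0 mod 2 ^ t"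
proof -
  have k': "k - 1 = Suc (k - 2)" using k by simp
  have "A (k - 2) (x + i * n ^ (k - 1)) 0 = A (k - 2) x 0"
    using k n by (intro and_words_cong digit_add_high) auto
  moreover have "digit n (k - 1) (x + i * n ^ (k - 1)) = i" by (rule digit_add_top[OF assms])
  ultimately have "A (k - 1) (x + i * n ^ (k - 1)) 0 = A (k - 2) x 0 AND W (k - 1) i 0"
    using and_words.simps(2)[of n d w U "x + i * n ^ (k - 1)" 0 "k - 2"] unfolding k' by simp
  then show ?thesis unfolding mask_def take_bit_eq_mod[symmetric]
    by (auto intro!: bit_eqI simp: bit_take_bit_iff bit_and_iff)
qed

text \<open>The mask loses no solution: a conjunction whose first word is zero passes the test on
  \<open>t\<close> of its bits.\<close>

lemma found_if_full:
  assumes "full y"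
  shows "found (n ^ (k - 1))"
proof -
  let ?x = "y mod n ^ (k - 1)" and ?i = "y div n ^ (k - 1)"
  have y: "y < n ^ k" "A (k - 1) y 0 = 0" using assms h_pos by (auto simp: full_def)
  have "n ^ k = n * n ^ (k - 1)" using k by (simp flip: power_Suc)
  then have i: "?i < n" using y(1) by (simp add: less_mult_imp_div_less)
  have x: "?x < n ^ (k - 1)" using tuple_bound(1) by (intro mod_less_divisor) linarith
  have eq: "?x + ?i * n ^ (k - 1) = y" by (rule mod_div_mult_eq)
  have "?i \<in> set (bucket (mask ?x))"
    using candidate_iff[OF x i] i y(2) unfolding eq by (simp add: bucket_def)
  then show ?thesis unfolding found_def using x eq assms by metis
qed

text \<open>The 2 in \<open>tuple_cost\<close> pays for the leading 1 and for word 0. Passing any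
  further word \<open>q\<close> requires words 0 to \<open>q - 1\<close> to be zero, which is the
  indicator with index \<open>q\<close>.\<close>

lemma tuple_cost_bound:
  assumes "A (k - 1) y 0 mod 2 ^ t = 0" "t \<le> d"
  shows "1 + scan y \<le> tuple_cost k n w h t U y"
proof -
  have "orth_upto k n U y t" unfolding orth_upto_def
  proof (intro allI impI)
    fix j assume j: "j < t"
    then have "\<not> bit (take_bit t (A (k - 1) y 0)) j"
      using assms(1) by (simp add: take_bit_eq_mod)
    then show "\<exists>l<k. \<not> U l (digit n l y) j"
      using j assms(2) t_less by (auto simp: bit_and_words bit_take_bit_iff le_pred_iff)
  qed
  moreover have "scan y \<le> 1 + (\<Sum>q\<in>{1..<h}. of_bool (orth_upto k n U y (q * w)))"
  proof -
    have "scan y \<le> 1 + (\<Sum>q\<in>{1..<scan y}. 1)" by simp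
    also have "(\<Sum>q\<in>{1..<scan y}. 1 :: nat) = (\<Sum>q\<in>{1..<scan y}. of_bool (orth_upto k n U y (q * w)))"
    proof (intro sum.cong refl)
      fix q assume q: "q \<in> {1..<scan y}"
      then have "q < h" using scan_le[of y] by simp
      have "orth_upto k n U y (q * w)" unfolding orth_upto_def
        using orth_if_words_zero[of q y] mult_le_if_less_words_per_row[OF \<open>q < h\<close>] q zero_if_less_scan[of _ y]
        by (meson atLeastLessThan_iff less_le_trans less_trans)
      then show "1 = (of_bool (orth_upto k n U y (q * w)) :: nat)" by simp
    qed
    also have "\<dots> \<le> (\<Sum>q\<in>{1..<h}. of_bool (orth_upto k n U y (q * w)))"
      using scan_le[of y] by (intro sum_mono2) auto
    finally show ?thesis by simp
  qed
  ultimately show ?thesis by (simp add: tuple_cost_def)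
qed

text \<open>The set of candidates depends on the instance. The indicators in
  \<open>tuple_cost\<close> absorb this dependence, leaving a sum over a fixed index set to which
  linearity of expectation applies.\<close>

lemma search_cost_bound:
  assumes "t \<le> d"
  shows "(\<Sum>x<n ^ (k - 1). \<Sum>i\<leftarrow>bucket (mask x). 1 + scan (x + i * n ^ (k - 1))) \<le>
    (\<Sum>y<n ^ k. tuple_cost k n w h t U y)"
proof -
  have nk: "n ^ k = n * n ^ (k - 1)" using k by (simp flip: power_Suc)
  have "(\<Sum>i\<leftarrow>bucket (mask x). 1 + scan (x + i * n ^ (k - 1))) \<le>
      (\<Sum>i<n. tuple_cost k n w h t U (x + i * n ^ (k - 1)))" if x: "x < n ^ (k - 1)" for x
  proof -
    have "distinct (bucket (mask x))" by (simp add: bucket_def)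
    then have "(\<Sum>i\<leftarrow>bucket (mask x). 1 + scan (x + i * n ^ (k - 1))) =
        (\<Sum>i\<in>set (bucket (mask x)). 1 + scan (x + i * n ^ (k - 1)))"
      by (rule sum_list_distinct_conv_sum_set)
    also have "\<dots> \<le> (\<Sum>i\<in>set (bucket (mask x)). tuple_cost k n w h t U (x + i * n ^ (k - 1)))"
    proof (rule sum_mono)
      fix i assume "i \<in> set (bucket (mask x))"
      then have "i < n" "W (k - 1) i 0 AND mask x = 0" by (auto simp: bucket_def)
      then show "1 + scan (x + i * n ^ (k - 1)) \<le> tuple_cost k n w h t U (x + i * n ^ (k - 1))"
        using candidate_iff[OF x] tuple_cost_bound[OF _ assms] by simp
    qed
    also have "\<dots> \<le> (\<Sum>i<n. tuple_cost k n w h t U (x + i * n ^ (k - 1)))"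
      by (rule sum_mono2) (auto simp: bucket_def)
    finally show ?thesis .
  qed
  then show ?thesis unfolding nk sum_digit_split by (intro sum_mono) simp
qed

text \<open>The tuple \<open>s\<close> only certifies that a solution exists; the output may be a
  different one.\<close>

lemma kov_prog_correct:
  assumes s: "\<forall>l<k. s l < n" "orthogonal_vecs k d (\<lambda>l. U l (s l))" and td: "t \<le> d"
  shows "runs w (kov_prog k)
    (time_const k * (n ^ (k - 1) * 2 ^ t + (\<Sum>y<n ^ k. tuple_cost k n w h t U y)))
    (input_state w k n d U)
    (\<lambda>\<sigma>. (\<forall>l<k. fst \<sigma> l < n) \<and> orthogonal_vecs k d (\<lambda>l. U l (fst \<sigma> l)))"
proof -
  obtain y where y: "y < n ^ k" "\<And>l. l < k \<Longrightarrow> digit n l y = s l"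
    using ex_digits[of n k s] s(1) n by auto
  have "orthogonal_vecs k d (\<lambda>l. U l (digit n l y)) = orthogonal_vecs k d (\<lambda>l. U l (s l))"
    by (rule orthogonal_vecs_cong) (simp add: y(2))
  with y(1) s(2) have "full y" by (simp add: full_iff)
  then have found: "found (n ^ (k - 1))" by (rule found_if_full)
  define S where "S = (\<Sum>y<n ^ k. tuple_cost k n w h t U y)"
  define b where "b = (\<Sum>x<n ^ (k - 1). bucket_cost k + (\<Sum>i\<leftarrow>bucket (mask x).
        (scan_cost k + bucket_cost k) * (1 + scan (x + i * n ^ (k - 1))))) + (n ^ (k - 1) + 1) * 4"
  have "runs w (kov_prog k)
    (prog_cost (init_prog k) + ((2 + ((t + 1) * 30 + (prog_cost (setup_prog k) +
      ((2 ^ t * (n + 1) * fill_cost k + (2 ^ t + 1) * 4) + b)))) + prog_cost (output_prog k k)))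
    (input_state w k n d U)
    (\<lambda>\<sigma>. (\<forall>l<k. fst \<sigma> l < n) \<and> orthogonal_vecs k d (\<lambda>l. U l (fst \<sigma> l)))"
    unfolding kov_prog_def
  proof (rule runs_Then, rule runs_mono[OF init_prog_correct order_refl], rule runs_Then)
    fix \<sigma> assume 1: "env \<sigma> \<and> fst \<sigma> (k + 8) = 1 \<and> fst \<sigma> (k + 4) = d"
    have main: "runs w (Then (double_prog k) (Then (setup_prog k) (Then (table_prog k) (search_prog k))))
      ((t + 1) * 30 + (prog_cost (setup_prog k) +
      ((2 ^ t * (n + 1) * fill_cost k + (2 ^ t + 1) * 4) + b))) \<sigma> (search_inv (n ^ (k - 1)))"
    proof (rule runs_Then, rule runs_mono[OF double_prog_correct order_refl])
      fix \<sigma> assume "env \<sigma> \<and> fst \<sigma> (k + 8) = 2 ^ t"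
      then show "runs w (Then (setup_prog k) (Then (table_prog k) (search_prog k)))
        (prog_cost (setup_prog k) + ((2 ^ t * (n + 1) * fill_cost k + (2 ^ t + 1) * 4) + b)) \<sigma> (search_inv (n ^ (k - 1)))"
      proof (intro runs_Then, elim conjE, intro runs_mono[OF setup_prog_correct order_refl])
        fix \<sigma> assume "env' \<sigma> \<and> fst \<sigma> (k + 10) = 0 \<and> fst \<sigma> (k + 13) = 0 \<and> fst \<sigma> (k + 16) = 0"
        then have start: "table_inv 0 \<sigma>" by (simp add: table_inv_def tab_def)
        show "runs w (Then (table_prog k) (search_prog k))
          ((2 ^ t * (n + 1) * fill_cost k + (2 ^ t + 1) * 4) + b) \<sigma> (search_inv (n ^ (k - 1)))"
        proof (rule runs_Then, rule runs_mono[OF table_prog_correct[OF start] order_refl])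
          fix \<sigma> assume "table_inv (2 ^ t) \<sigma>"
          then have "search_inv 0 \<sigma>" using n
            by (simp add: table_inv_def search_inv_def search_env_def found_def)
          then show "runs w (search_prog k) b \<sigma> (search_inv (n ^ (k - 1)))"
            unfolding b_def by (rule search_prog_correct)
        qed
      qed
    qed (use 1 in auto)
    have nz: "ram_val w \<sigma> (Reg (k + 4)) \<noteq> 0" using 1 d fits'(5) by simp
    show "runs w (Cond (Reg (k + 4))
        (Then (double_prog k) (Then (setup_prog k) (Then (table_prog k) (search_prog k)))) Skip)
      (2 + ((t + 1) * 30 + (prog_cost (setup_prog k) +
      ((2 ^ t * (n + 1) * fill_cost k + (2 ^ t + 1) * 4) + b)))) \<sigma>
      (\<lambda>\<sigma>'. runs w (output_prog k k) (prog_cost (output_prog k k)) \<sigma>'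
        (\<lambda>\<sigma>. (\<forall>l<k. fst \<sigma> l < n) \<and> orthogonal_vecs k d (\<lambda>l. U l (fst \<sigma> l))))"
    proof (rule runs_mono[OF runs_Cond_True[OF nz main]])
      fix \<sigma> assume "search_inv (n ^ (k - 1)) \<sigma>"
      then have *: "env \<sigma>" "fst \<sigma> (k + 16) < n ^ k" "full (fst \<sigma> (k + 16))"
        using found by (simp_all add: search_inv_def search_env_def env'_def)
      show "runs w (output_prog k k) (prog_cost (output_prog k k)) \<sigma>
        (\<lambda>\<sigma>. (\<forall>l<k. fst \<sigma> l < n) \<and> orthogonal_vecs k d (\<lambda>l. U l (fst \<sigma> l)))"
      proof (rule runs_mono[OF output_prog_correct[OF *(1,2) order_refl] order_refl])
        fix \<sigma>' assume out: "\<forall>l<k. fst \<sigma>' l = digit n l (fst \<sigma> (k + 16))"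
        then have "orthogonal_vecs k d (\<lambda>l. U l (fst \<sigma>' l)) =
            orthogonal_vecs k d (\<lambda>l. U l (digit n l (fst \<sigma> (k + 16))))"
          by (intro orthogonal_vecs_cong) simp
        then show "(\<forall>l<k. fst \<sigma>' l < n) \<and> orthogonal_vecs k d (\<lambda>l. U l (fst \<sigma>' l))"
          using *(3) out digit_less[of n] n by (simp add: full_iff)
      qed
    qed simp
  qed
  then show ?thesis
  proof (rule runs_mono)
    let ?X = "n ^ (k - 1) * 2 ^ t"
    have "b = n ^ (k - 1) * bucket_cost k + (scan_cost k + bucket_cost k) *
      (\<Sum>x<n ^ (k - 1). \<Sum>i\<leftarrow>bucket (mask x). 1 + scan (x + i * n ^ (k - 1))) + (n ^ (k - 1) + 1) * 4"
      unfolding b_def by (simp only: sum.distrib sum_list_const_mult sum_distrib_left sum_constant card_lessThan of_nat_id)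
    also have "\<dots> \<le> n ^ (k - 1) * bucket_cost k + (scan_cost k + bucket_cost k) * S + (n ^ (k - 1) + 1) * 4"
      using search_cost_bound[OF td] unfolding S_def by simp
    finally have b: "b \<le> \<dots>" .
    \<comment> \<open>Everything outside the scans is charged to \<open>?X\<close>. That the table
      fits in as well uses \<open>k \<ge> 2\<close>.\<close>
    have X: "n * 2 ^ t \<le> ?X" "n ^ (k - 1) \<le> ?X" "2 ^ t \<le> ?X" "1 \<le> ?X" "t \<le> ?X"
    proof -
      have "n ^ 1 \<le> n ^ (k - 1)" using n k by (intro power_increasing) auto
      then show "n * 2 ^ t \<le> ?X" by simp
      show "n ^ (k - 1) \<le> ?X" by simp
      show "2 ^ t \<le> ?X" "1 \<le> ?X" using n by (simp_all add: Suc_le_eq)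
      then show "t \<le> ?X" using less_exp[of t] by linarith
    qed
    have "2 ^ t * (n + 1) = n * 2 ^ t + 2 ^ t" by (simp add: algebra_simps)
    then have "2 ^ t * (n + 1) \<le> 2 * ?X" using X(1,3) by linarith
    then have "2 ^ t * (n + 1) * fill_cost k \<le> 2 * ?X * fill_cost k" by (rule mult_le_mono1)
    moreover have "n ^ (k - 1) * bucket_cost k \<le> ?X * bucket_cost k" using X(2) by (intro mult_le_mono1)
    moreover have "prog_cost (init_prog k) \<le> ?X * prog_cost (init_prog k)"
      "prog_cost (setup_prog k) \<le> ?X * prog_cost (setup_prog k)"
      "prog_cost (output_prog k k) \<le> ?X * prog_cost (output_prog k k)"
      using X(4) by simp_all
    moreover have "(scan_cost k + bucket_cost k) * S \<le> time_const k * S"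
      by (intro mult_le_mono1) (simp add: time_const_def)
    ultimately have "prog_cost (init_prog k) + ((2 + ((t + 1) * 30 + (prog_cost (setup_prog k) +
      ((2 ^ t * (n + 1) * fill_cost k + (2 ^ t + 1) * 4) + b)))) + prog_cost (output_prog k k))
      \<le> ?X * prog_cost (init_prog k) + ?X * prog_cost (setup_prog k) +
      2 * ?X * fill_cost k + ?X * bucket_cost k + ?X * prog_cost (output_prog k k) + 80 * ?X + time_const k * S"
      using b by (intro cost_arith[OF X(5,3,2,4)])
    also have "\<dots> \<le> time_const k * (?X + S)"
      by (simp add: time_const_def algebra_simps)
    finally show "prog_cost (init_prog k) + ((2 + ((t + 1) * 30 + (prog_cost (setup_prog k) +
      ((2 ^ t * (n + 1) * fill_cost k + (2 ^ t + 1) * 4) + b)))) + prog_cost (output_prog k k))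
      \<le> time_const k * (?X + (\<Sum>y<n ^ k. tuple_cost k n w h t U y))"
      unfolding S_def .
  qed
qed

end

subsection \<open>The planted distribution\<close>

text \<open>A pointwise comparison along the two stages, which avoids describing the law of the
  bind. In the application \<open>a\<close> is the null instance and \<open>b\<close> the planted
  one.\<close>

lemma expectation_bind_le:
  fixes f :: "'b \<Rightarrow> real" and g :: "'a \<Rightarrow> real"
  assumes "finite (set_pmf p)" "\<And>a. a \<in> set_pmf p \<Longrightarrow> finite (set_pmf (M a))"
    and le: "\<And>a b. a \<in> set_pmf p \<Longrightarrow> b \<in> set_pmf (M a) \<Longrightarrow> f b \<le> g a"
  shows "measure_pmf.expectation (bind_pmf p M) f \<le> measure_pmf.expectation p g"
proof -
  have inner: "measure_pmf.expectation (M a) f \<le> g a" if "a \<in> set_pmf p" for a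
    by (rule measure_pmf.integral_le_const)
      (use assms that in \<open>auto intro!: integrable_measure_pmf_finite simp: AE_measure_pmf_iff\<close>)
  have "measure_pmf.expectation (bind_pmf p M) f =
      (\<Sum>a\<in>set_pmf p. pmf p a *\<^sub>R measure_pmf.expectation (M a) f)"
    by (rule pmf_expectation_bind) (use assms in auto)
  also have "\<dots> \<le> (\<Sum>a\<in>set_pmf p. pmf p a *\<^sub>R g a)"
    by (intro sum_mono scaleR_left_mono inner) auto
  also have "\<dots> = measure_pmf.expectation p g"
    by (rule integral_measure_pmf[symmetric]) (use assms in auto)
  finally show ?thesis .
qed

lemma finite_set_Pi_pmf:
  "finite A \<Longrightarrow> (\<And>x. x \<in> A \<Longrightarrow> finite (set_pmf (p x))) \<Longrightarrow> finite (set_pmf (Pi_pmf A dflt p))"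
  by (simp add: set_Pi_pmf finite_PiE_dflt)

lemma finite_set_pmf_bool: "finite (set_pmf (p :: bool pmf))"
  by (rule finite_subset[OF subset_UNIV]) simp

section \<open>Orthogonality on initial coordinates in the null model\<close>

lemma expectation_prod_bernoulli:
  assumes "finite S" "Z \<subseteq> S" "0 \<le> p" "p \<le> 1"
  shows "measure_pmf.expectation (Pi_pmf S False (\<lambda>_. bernoulli_pmf p))
    (\<lambda>f. \<Prod>x\<in>Z. of_bool (f x) :: real) = p ^ card Z"
proof -
  have "(\<Prod>x\<in>Z. of_bool (f x) :: real) = (\<Prod>x\<in>S. if x \<in> Z then of_bool (f x) else 1)" for f
    using assms(1,2) by (intro prod.mono_neutral_cong_left) auto
  then have "measure_pmf.expectation (Pi_pmf S False (\<lambda>_. bernoulli_pmf p))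
    (\<lambda>f. \<Prod>x\<in>Z. of_bool (f x) :: real) =
    measure_pmf.expectation (Pi_pmf S False (\<lambda>_. bernoulli_pmf p))
    (\<lambda>f. \<Prod>x\<in>S. (\<lambda>x b. if x \<in> Z then of_bool b else 1 :: real) x (f x))" by simp
  also have "\<dots> = (\<Prod>x\<in>S. measure_pmf.expectation (bernoulli_pmf p) (\<lambda>b. if x \<in> Z then of_bool b else 1))"
    using assms(1)
    by (intro expectation_prod_Pi_pmf) (auto intro!: integrable_measure_pmf_finite finite_set_pmf_bool)
  also have "\<dots> = (\<Prod>x\<in>S. if x \<in> Z then p else 1)"
    using assms(3,4) by (intro prod.cong) auto
  also have "\<dots> = (\<Prod>x\<in>Z. p)"
    using assms(1,2) by (intro prod.mono_neutral_cong_right) auto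
  finally show ?thesis by simp
qed

text \<open>The extra factor over \<open>Z\<close> makes the induction on the number of columns close:
  \<open>(1 - \<Prod>\<^sub>C) \<Prod>\<^sub>Z = \<Prod>\<^sub>Z - \<Prod>\<^sub>Z\<^sub>\<union>\<^sub>C\<close> for a fresh column \<open>C\<close>.\<close>

lemma expectation_columns_aux:
  assumes "finite S" "0 \<le> p" "p \<le> 1" "\<And>j l. j < r \<Longrightarrow> l < k \<Longrightarrow> (l, i l, j) \<in> S"
    and "Z \<subseteq> S" "\<And>j l. j < r \<Longrightarrow> l < k \<Longrightarrow> (l, i l, j) \<notin> Z"
  shows "measure_pmf.expectation (Pi_pmf S False (\<lambda>_. bernoulli_pmf p))
    (\<lambda>f. (\<Prod>j<r. 1 - (\<Prod>l<k. of_bool (f (l, i l, j)))) * (\<Prod>x\<in>Z. of_bool (f x)) :: real) =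
    (1 - p ^ k) ^ r * p ^ card Z"
  using assms(4-6)
proof (induction r arbitrary: Z)
  case 0
  then show ?case using expectation_prod_bernoulli[OF assms(1) _ assms(2,3), of Z] by simp
next
  case (Suc r)
  define C where "C = (\<lambda>l. (l, i l, r)) ` {..<k}"
  have C: "finite C" "C \<subseteq> S" "C \<inter> Z = {}" "card C = k"
    using Suc.prems by (auto simp: C_def card_image inj_on_def)
  have finZ: "finite Z" using Suc.prems(2) assms(1) finite_subset by blast
  have prodC: "(\<Prod>l<k. of_bool (f (l, i l, r)) :: real) = (\<Prod>x\<in>C. of_bool (f x))" for f
    unfolding C_def by (subst prod.reindex) (auto simp: inj_on_def)
  let ?E = "measure_pmf.expectation (Pi_pmf S False (\<lambda>_. bernoulli_pmf p))"
  let ?P = "\<lambda>f. \<Prod>j<r. 1 - (\<Prod>l<k. of_bool (f (l, i l, j))) :: real"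
  have int: "integrable (measure_pmf (Pi_pmf S False (\<lambda>_. bernoulli_pmf p))) g" for g :: "_ \<Rightarrow> real"
    by (intro integrable_measure_pmf_finite finite_set_Pi_pmf assms(1) finite_set_pmf_bool)
  have "?E (\<lambda>f. (\<Prod>j<Suc r. 1 - (\<Prod>l<k. of_bool (f (l, i l, j)))) * (\<Prod>x\<in>Z. of_bool (f x))) =
    ?E (\<lambda>f. ?P f * (\<Prod>x\<in>Z. of_bool (f x)) - ?P f * (\<Prod>x\<in>C \<union> Z. of_bool (f x)))"
    using C finZ by (simp add: prodC prod.union_disjoint algebra_simps)
  also have "\<dots> = ?E (\<lambda>f. ?P f * (\<Prod>x\<in>Z. of_bool (f x))) - ?E (\<lambda>f. ?P f * (\<Prod>x\<in>C \<union> Z. of_bool (f x)))"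
    by (rule Bochner_Integration.integral_diff) (rule int)+
  also have "?E (\<lambda>f. ?P f * (\<Prod>x\<in>Z. of_bool (f x))) = (1 - p ^ k) ^ r * p ^ card Z"
    by (rule Suc.IH) (use Suc.prems in auto)
  also have "?E (\<lambda>f. ?P f * (\<Prod>x\<in>C \<union> Z. of_bool (f x))) = (1 - p ^ k) ^ r * p ^ card (C \<union> Z)"
    by (rule Suc.IH) (use Suc.prems C in \<open>auto simp: C_def\<close>)
  also have "card (C \<union> Z) = k + card Z"
    using C finZ by (simp add: card_Un_disjoint)
  finally show ?case by (simp add: power_add algebra_simps)
qed

lemma finite_set_kov0: "finite (set_pmf (kov0 k \<alpha> n))"
  unfolding kov0_def by (auto intro!: finite_set_Pi_pmf finite_set_pmf_bool)

lemma prod_of_bool: "finite A \<Longrightarrow> (\<Prod>x\<in>A. of_bool (P x)) = (of_bool (\<forall>x\<in>A. P x) :: real)"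
  by (induction A rule: finite_induct) auto

text \<open>The entries of a tuple lie in different matrices or columns, so they are distinct
  independent cells, and each column is all ones with probability \<open>p ^ k\<close>.\<close>

lemma expectation_orth_upto:
  assumes "0 \<le> kov_prob k \<alpha> n" "kov_prob k \<alpha> n \<le> 1" "r \<le> kov_dim \<alpha> n" "0 < n"
  shows "measure_pmf.expectation (kov0 k \<alpha> n) (\<lambda>U. of_bool (orth_upto k n U y r)) =
    (1 - kov_prob k \<alpha> n ^ k) ^ r"
proof -
  have "of_bool (orth_upto k n U y r) =
      (\<Prod>j<r. 1 - (\<Prod>l<k. of_bool (U l (digit n l y) j)) :: real)" for U
  proof -
    have "1 - (\<Prod>l<k. of_bool (U l (digit n l y) j)) = (of_bool (\<exists>l<k. \<not> U l (digit n l y) j) :: real)" for j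
      by (subst prod_of_bool) auto
    then show ?thesis by (simp add: prod_of_bool orth_upto_def Ball_def)
  qed
  then show ?thesis
    using expectation_columns_aux[of "{..<k} \<times> {..<n} \<times> {..<kov_dim \<alpha> n}" "kov_prob k \<alpha> n" r k
        "\<lambda>l. digit n l y" "{}"] assms digit_less[of n]
    by (simp add: kov0_def)
qed

lemma expectation_tuple_cost:
  assumes "0 \<le> kov_prob k \<alpha> n" "kov_prob k \<alpha> n \<le> 1" "t \<le> kov_dim \<alpha> n" "0 < n"
    and "\<And>q. q < h \<Longrightarrow> q * w \<le> kov_dim \<alpha> n"
  shows "measure_pmf.expectation (kov0 k \<alpha> n) (\<lambda>U. real (tuple_cost k n w h t U y)) =
    2 * (1 - kov_prob k \<alpha> n ^ k) ^ t + (\<Sum>q\<in>{1..<h}. (1 - kov_prob k \<alpha> n ^ k) ^ (q * w))"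
proof -
  have int: "integrable (measure_pmf (kov0 k \<alpha> n)) g" for g :: "_ \<Rightarrow> real"
    by (intro integrable_measure_pmf_finite finite_set_kov0)
  have "(\<lambda>U. real (tuple_cost k n w h t U y)) = (\<lambda>U. 2 * of_bool (orth_upto k n U y t) +
     (\<Sum>q\<in>{1..<h}. of_bool (orth_upto k n U y (q * w))))"
    by (simp add: tuple_cost_def fun_eq_iff)
  then have "measure_pmf.expectation (kov0 k \<alpha> n) (\<lambda>U. real (tuple_cost k n w h t U y)) =
      2 * measure_pmf.expectation (kov0 k \<alpha> n) (\<lambda>U. of_bool (orth_upto k n U y t)) +
      (\<Sum>q\<in>{1..<h}. measure_pmf.expectation (kov0 k \<alpha> n) (\<lambda>U. of_bool (orth_upto k n U y (q * w))))"
    by (simp only: Bochner_Integration.integral_add[OF int int]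
        Bochner_Integration.integral_sum[OF int] integral_mult_right_zero)
  also have "\<dots> = 2 * (1 - kov_prob k \<alpha> n ^ k) ^ t + (\<Sum>q\<in>{1..<h}. (1 - kov_prob k \<alpha> n ^ k) ^ (q * w))"
    using assms(5) by (intro arg_cong2[of _ _ _ _ "(+)"] sum.cong)
      (simp_all only: expectation_orth_upto[OF assms(1,2,3,4)] expectation_orth_upto[OF assms(1,2) _ assms(4)]
        atLeastLessThan_iff refl)
  finally show ?thesis .
qed

section \<open>Planting and its effect on the cost\<close>

lemma finite_set_plant: "finite (set_pmf (plant k d p U s))"
  unfolding plant_def by (auto intro!: finite_set_Pi_pmf finite_set_pmf_bool)

lemma plant_unchanged:
  assumes "U' \<in> set_pmf (plant k d p U s)" "l \<noteq> k - 1 \<or> i \<noteq> s (k - 1)"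
  shows "U' l i = U l i"
  using assms by (auto simp: plant_def fun_eq_iff)

text \<open>A column with \<open>k\<close> ones is flipped with probability
  \<open>(p / (1 - p)) ^ 0 = 1\<close>. One with \<open>k - 1\<close> ones has odd deficit and is
  never flipped, so it cannot become all ones. With fewer ones, a zero survives any single
  flip.\<close>

lemma plant_orthogonal:
  assumes "U' \<in> set_pmf (plant k d p U s)" "0 < k"
  shows "orthogonal_vecs k d (\<lambda>l. U' l (s l))"
  unfolding orthogonal_vecs_iff
proof (intro allI impI)
  fix j assume j: "j < d"
  define Z where "Z = {l. l < k \<and> U l (s l) j}"
  obtain F where F: "F \<in> set_pmf (Pi_pmf {..<d} False (\<lambda>j. flip_pmf k p (card {l. l < k \<and> U l (s l) j})))"
    and U': "U' = (\<lambda>l i j. if l = k - 1 \<and> i = s (k - 1) \<and> F j then \<not> U l i j else U l i j)"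
    using assms(1) by (auto simp: plant_def)
  have Fj: "F j \<in> set_pmf (flip_pmf k p (card Z))"
    using F j by (auto simp: set_Pi_pmf PiE_dflt_def Z_def)
  have Z: "Z \<subseteq> {..<k}" by (auto simp: Z_def)
  show "\<exists>l<k. \<not> U' l (s l) j"
  proof (cases "Z = {..<k}")
    case True
    then have "F j \<in> set_pmf (bernoulli_pmf 1)" using Fj by (simp add: flip_pmf_def)
    then have "pmf (bernoulli_pmf 1) (F j) \<noteq> 0" by (rule iffD1[OF set_pmf_iff])
    then have "F j" by (cases "F j") simp_all
    moreover have "k - 1 \<in> Z" using True assms(2) by simp
    then have "U (k - 1) (s (k - 1)) j" by (simp add: Z_def)
    ultimately show ?thesis using assms(2) by (intro exI[of _ "k - 1"]) (simp add: U')
  next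
    case False
    have "\<exists>l<k. \<not> U l (s l) j \<and> (F j \<longrightarrow> l \<noteq> k - 1)"
    proof (rule ccontr)
      assume neg: "\<not> ?thesis"
      have "\<exists>l<k. \<not> U l (s l) j" using False unfolding Z_def by blast
      with neg have "F j" by blast
      have "{..<k} - {k - 1} \<subseteq> Z" using neg unfolding Z_def by blast
      then have "Z = {..<k} - {k - 1}" using False Z by blast
      then have "card Z = k - 1" using assms(2) by simp
      then have "k - card Z = 1" using assms(2) by simp
      then show False using Fj \<open>F j\<close> by (simp add: flip_pmf_def)
    qed
    then show ?thesis by (auto simp: U')
  qed
qed

lemma tuple_cost_le: "tuple_cost k n w h t U y \<le> 2 + h"
proof -
  have "(\<Sum>q\<in>{1..<h}. of_bool (orth_upto k n U y (q * w))) \<le> (\<Sum>q\<in>{1..<h}. 1 :: nat)"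
    by (intro sum_mono) simp
  also have "\<dots> \<le> h" by simp
  finally show ?thesis unfolding tuple_cost_def by (intro add_mono) auto
qed

text \<open>Planting changes a single row of the last matrix, so only \<open>n ^ (k - 1)\<close> tuples are affected.\<close>

lemma tuple_cost_plant:
  assumes "U' \<in> set_pmf (plant k d p U s)" "2 \<le> k" "0 < n"
  shows "(\<Sum>y<n ^ k. tuple_cost k n w h t U' y) \<le>
    (\<Sum>y<n ^ k. tuple_cost k n w h t U y) + n ^ (k - 1) * (2 + h)"
proof -
  let ?N = "n ^ (k - 1)"
  have nk: "n ^ k = n * ?N" using assms(2) by (simp flip: power_Suc)
  have "(\<Sum>i<n. tuple_cost k n w h t U' (x + i * ?N)) \<le>
      (\<Sum>i<n. tuple_cost k n w h t U (x + i * ?N)) + (2 + h)" if x: "x < ?N" for x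
  proof -
    have "tuple_cost k n w h t U' (x + i * ?N) \<le>
        tuple_cost k n w h t U (x + i * ?N) + (if i = s (k - 1) then 2 + h else 0)" if "i < n" for i
    proof (cases "i = s (k - 1)")
      case True
      then show ?thesis unfolding if_P[OF True] by (intro trans_le_add2 tuple_cost_le)
    next
      case False
      have "U' l (digit n l (x + i * ?N)) = U l (digit n l (x + i * ?N))" for l
        using plant_unchanged[OF assms(1)] digit_add_top[OF x that] False by metis
      then have "orth_upto k n U' (x + i * ?N) r = orth_upto k n U (x + i * ?N) r" for r
        by (simp add: orth_upto_def)
      then show ?thesis by (simp add: tuple_cost_def)
    qed
    then have "(\<Sum>i<n. tuple_cost k n w h t U' (x + i * ?N)) \<le>
      (\<Sum>i<n. tuple_cost k n w h t U (x + i * ?N) + (if i = s (k - 1) then 2 + h else 0))"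
      by (intro sum_mono) auto
    also have "\<dots> \<le> (\<Sum>i<n. tuple_cost k n w h t U (x + i * ?N)) + (2 + h)"
      by (simp add: sum.distrib)
    finally show ?thesis .
  qed
  then have "(\<Sum>x<?N. \<Sum>i<n. tuple_cost k n w h t U' (x + i * ?N)) \<le>
      (\<Sum>x<?N. (\<Sum>i<n. tuple_cost k n w h t U (x + i * ?N)) + (2 + h))"
    by (intro sum_mono) auto
  then show ?thesis unfolding nk sum_digit_split
    by (simp only: sum.distrib sum_constant card_lessThan of_nat_id distrib_left)
qed

lemma set_kov1:
  assumes "U' \<in> set_pmf (kov1 k \<alpha> n)" "0 < n"
  obtains U s where "U \<in> set_pmf (kov0 k \<alpha> n)" "\<And>l. l < k \<Longrightarrow> s l < n"
    "U' \<in> set_pmf (plant k (kov_dim \<alpha> n) (kov_prob k \<alpha> n) U s)"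
proof -
  have "{..<k} \<rightarrow>\<^sub>E {..<n} \<noteq> {}" using assms(2) by (auto simp: PiE_eq_empty_iff)
  then have supp: "set_pmf (pmf_of_set ({..<k} \<rightarrow>\<^sub>E {..<n})) = {..<k} \<rightarrow>\<^sub>E {..<n}"
    by (rule set_pmf_of_set) (simp add: finite_PiE)
  obtain U s where U: "U \<in> set_pmf (kov0 k \<alpha> n)" "s \<in> {..<k} \<rightarrow>\<^sub>E {..<n}"
    "U' \<in> set_pmf (plant k (kov_dim \<alpha> n) (kov_prob k \<alpha> n) U s)"
    using assms(1) unfolding kov1_def set_bind_pmf supp by blast
  have "s l < n" if "l < k" for l using PiE_mem[OF U(2), of l] that by simp
  with U that show thesis by blast
qed

text \<open>Here \<open>m\<close> is the deterministic part of the time. The middle summand charges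
  the worst cost \<open>2 + h\<close> to each of the \<open>n ^ (k - 1)\<close> tuples through the
  modified row, and the last one is the null-model expectation over all tuples.\<close>

lemma expectation_kov1_le:
  assumes "2 \<le> k" "0 < n" "0 \<le> kov_prob k \<alpha> n" "kov_prob k \<alpha> n \<le> 1" "t \<le> kov_dim \<alpha> n"
    and "\<And>q. q < h \<Longrightarrow> q * w \<le> kov_dim \<alpha> n"
    and T: "\<And>U. U \<in> set_pmf (kov1 k \<alpha> n) \<Longrightarrow> T U \<le> c * (m + (\<Sum>y<n ^ k. tuple_cost k n w h t U y))"
  shows "measure_pmf.expectation (kov1 k \<alpha> n) (\<lambda>U. real (T U)) \<le>
    real c * (real m + real (n ^ (k - 1) * (2 + h)) + real (n ^ k) *
      (2 * (1 - kov_prob k \<alpha> n ^ k) ^ t + (\<Sum>q\<in>{1..<h}. (1 - kov_prob k \<alpha> n ^ k) ^ (q * w))))"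
proof -
  let ?g = "\<lambda>U. real c * (real m + real (n ^ (k - 1) * (2 + h)) + (\<Sum>y<n ^ k. real (tuple_cost k n w h t U y)))"
  let ?M = "\<lambda>U. bind_pmf (pmf_of_set ({..<k} \<rightarrow>\<^sub>E {..<n})) (plant k (kov_dim \<alpha> n) (kov_prob k \<alpha> n) U)"
  have int: "integrable (measure_pmf (kov0 k \<alpha> n)) g" for g :: "_ \<Rightarrow> real"
    by (intro integrable_measure_pmf_finite finite_set_kov0)
  have ne: "{..<k} \<rightarrow>\<^sub>E {..<n} \<noteq> {}" using assms(2) by (auto simp: PiE_eq_empty_iff)
  have fin: "finite ({..<k} \<rightarrow>\<^sub>E {..<n})" by (intro finite_PiE) auto
  have "measure_pmf.expectation (kov1 k \<alpha> n) (\<lambda>U. real (T U)) \<le> measure_pmf.expectation (kov0 k \<alpha> n) ?g"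
    unfolding kov1_def
  proof (rule expectation_bind_le[OF finite_set_kov0])
    show "finite (set_pmf (?M U))" for U
      using ne fin by (auto intro: finite_set_plant)
    fix U U' assume U: "U \<in> set_pmf (kov0 k \<alpha> n)" and U': "U' \<in> set_pmf (?M U)"
    then obtain s where s: "U' \<in> set_pmf (plant k (kov_dim \<alpha> n) (kov_prob k \<alpha> n) U s)" by auto
    have "U' \<in> set_pmf (kov1 k \<alpha> n)" using U U' by (auto simp: kov1_def)
    then have "T U' \<le> c * (m + (\<Sum>y<n ^ k. tuple_cost k n w h t U' y))" by (rule T)
    also have "\<dots> \<le> c * (m + ((\<Sum>y<n ^ k. tuple_cost k n w h t U y) + n ^ (k - 1) * (2 + h)))"
      using tuple_cost_plant[OF s assms(1,2)] by (intro mult_le_mono2 add_left_mono)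
    finally have "real (T U') \<le> real (c * (m + ((\<Sum>y<n ^ k. tuple_cost k n w h t U y) + n ^ (k - 1) * (2 + h))))"
      by (rule of_nat_mono)
    also have "\<dots> = ?g U" by (simp add: algebra_simps)
    finally show "real (T U') \<le> ?g U" .
  qed
  also have "\<dots> = real c * (real m + real (n ^ (k - 1) * (2 + h)) +
      (\<Sum>y<n ^ k. measure_pmf.expectation (kov0 k \<alpha> n) (\<lambda>U. real (tuple_cost k n w h t U y))))"
    by (simp only: Bochner_Integration.integral_add[OF int int] Bochner_Integration.integral_sum[OF int]
        integral_mult_right_zero lebesgue_integral_const measure_pmf.prob_space scaleR_one)
  also have "\<dots> = real c * (real m + real (n ^ (k - 1) * (2 + h)) + real (n ^ k) *
      (2 * (1 - kov_prob k \<alpha> n ^ k) ^ t + (\<Sum>q\<in>{1..<h}. (1 - kov_prob k \<alpha> n ^ k) ^ (q * w))))"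
    using assms(2-6) by (simp add: expectation_tuple_cost)
  finally show ?thesis .
qed

subsection \<open>Asymptotics\<close>

text \<open>Covers \<open>n = 1\<close>, which \<open>kov_run\<close> excludes through
  \<open>1 \<le> d\<close>. The guard skips the search, and every digit of the initial answer 0
  evaluates to 0 for any word length.\<close>

lemma kov_prog_zero:
  assumes "2 \<le> k"
  shows "runs w (kov_prog k) (prog_cost (init_prog k) + (3 + prog_cost (output_prog k k)))
    (input_state w k n 0 U) (\<lambda>\<sigma>. \<forall>l<k. fst \<sigma> l = 0)"
  unfolding kov_prog_def
proof (rule runs_Then, rule runs_loop_free[OF _ _ order_refl])
  let ?\<sigma> = "run w (init_prog k) (input_state w k n 0 U)"
  have \<sigma>: "fst ?\<sigma> (k + 4) = 0" "fst ?\<sigma> (k + 16) = 0"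
    using assms by (simp_all add: init_prog_def input_state_def)
  show "runs w (Then (Cond (Reg (k + 4)) (Then (double_prog k)
      (Then (setup_prog k) (Then (table_prog k) (search_prog k)))) Skip) (output_prog k k))
      (3 + prog_cost (output_prog k k)) ?\<sigma> (\<lambda>\<sigma>. \<forall>l<k. fst \<sigma> l = 0)"
  proof (rule runs_Then, rule runs_mono[OF runs_Cond_False])
    show "runs w Skip 1 ?\<sigma> (\<lambda>\<sigma>. \<sigma> = ?\<sigma>)" by (rule runs_loop_free) auto
    fix \<sigma>' assume "\<sigma>' = ?\<sigma>"
    then have z: "fst \<sigma>' (k + 16) = 0" using \<sigma> by simp
    have "fst (run w (output_prog k m) \<sigma>') (k + 16) = 0 \<and> (\<forall>l<m. fst (run w (output_prog k m) \<sigma>') l = 0)"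
      if "m \<le> k" for m
      using that
    proof (induction m)
      case (Suc m)
      then have "ram_val w (run w (output_prog k m) \<sigma>') (digit_exp k (k + 16) m) = 0"
        by (simp add: digit_exp_def)
      then show ?case using Suc by (auto simp: less_Suc_eq)
    qed (use z in auto)
    moreover have "loop_free (output_prog k m)" for m by (induction m) auto
    ultimately show "runs w (output_prog k k) (prog_cost (output_prog k k)) \<sigma>' (\<lambda>\<sigma>. \<forall>l<k. fst \<sigma> l = 0)"
      by (intro runs_loop_free) auto
  qed (use \<sigma> in auto)
qed (simp add: init_prog_def)

section \<open>Sizes of the parameters and of a machine word\<close>

lemma kov_prob_power:
  assumes "0 < k" "0 < \<alpha> n"
  shows "0 \<le> kov_prob k \<alpha> n" "kov_prob k \<alpha> n ^ k = 1 - 2 powr (- 2 * real k / \<alpha> n)"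
proof -
  have "2 powr (- 2 * real k / \<alpha> n) < 2 powr 0" using assms by (intro powr_less_mono) auto
  then have pos: "0 < 1 - 2 powr (- 2 * real k / \<alpha> n)" by simp
  show "0 \<le> kov_prob k \<alpha> n" by (simp add: kov_prob_def)
  have "0 < kov_prob k \<alpha> n" unfolding kov_prob_def using pos by (simp only: powr_gt_zero)
  then have "kov_prob k \<alpha> n ^ k = kov_prob k \<alpha> n powr real k"
    by (rule powr_realpow[symmetric])
  also have "\<dots> = 1 - 2 powr (- 2 * real k / \<alpha> n)"
    using pos assms(1) by (simp add: kov_prob_def powr_powr)
  finally show "kov_prob k \<alpha> n ^ k = 1 - 2 powr (- 2 * real k / \<alpha> n)" .
qed

text \<open>From \<open>p \<le> 1/2\<close> and \<open>k \<ge> 2\<close> follows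
  \<open>p ^ k \<le> 1/4\<close>, so \<open>2 powr (- 2 k / \<alpha>)\<close> is at least 3/4, hence
  above 1/2, and its exponent is above -1.\<close>

lemma alpha_ge:
  assumes "2 \<le> k" "0 < \<alpha> n" "kov_prob k \<alpha> n \<le> 1 / 2"
  shows "2 * real k \<le> \<alpha> n"
proof -
  have "1 - 2 powr (- 2 * real k / \<alpha> n) = kov_prob k \<alpha> n ^ k"
    using kov_prob_power(2)[of k \<alpha> n] assms by simp
  also have "\<dots> \<le> (1 / 2) ^ k" using kov_prob_power(1)[of k \<alpha> n] assms by (intro power_mono) auto
  also have "\<dots> \<le> (1 / 2) ^ 2" using assms(1) by (intro power_decreasing) auto
  also have "(1 / 2 :: real) ^ 2 = 1 / 4" by (simp add: power2_eq_square)
  finally have "1 / 2 < (2 :: real) powr (- 2 * real k / \<alpha> n)" by linarith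
  moreover have "1 / 2 = (2 :: real) powr (- 1)" by (simp add: powr_minus_divide)
  ultimately have "(2 :: real) powr (- 1) < 2 powr (- 2 * real k / \<alpha> n)" by (simp only:)
  then have "- 1 < - 2 * real k / \<alpha> n" by (subst (asm) powr_less_cancel_iff) auto
  then show ?thesis using assms(2) by (simp add: field_simps)
qed

lemma sum_half_powers: "(\<Sum>q\<in>{1..<h}. (1 / 2 :: real) ^ q) \<le> 1"
proof (cases h)
  case (Suc m)
  have "(\<Sum>q\<in>{1..<Suc m}. (1 / 2 :: real) ^ q) = 1 - (1 / 2) ^ m"
    by (induction m) auto
  then show ?thesis using Suc by simp
qed simp

text \<open>\<open>n \<ge> 2\<close> makes the logarithm at least 1 and the dimension
  positive.\<close>

locale kov_params =
  fixes k n :: nat and \<alpha> :: "nat \<Rightarrow> real"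
  assumes k: "2 \<le> k" and n: "2 \<le> n" and \<alpha>: "0 < \<alpha> n" and p: "kov_prob k \<alpha> n \<le> 1 / 2"
begin

abbreviation "d \<equiv> kov_dim \<alpha> n"
abbreviation "w \<equiv> word_len (k + 10) \<alpha> n"
abbreviation "h \<equiv> words_per_row w d"
abbreviation "lg \<equiv> log 2 (real n)"
abbreviation "\<rho> \<equiv> 1 - kov_prob k \<alpha> n ^ k"

lemma alpha_ge_2k: "2 * real k \<le> \<alpha> n" using alpha_ge k \<alpha> p .

lemma alpha_ge_4: "4 \<le> \<alpha> n" using alpha_ge_2k k by simp

lemma log_ge_1: "1 \<le> lg" using n by (simp add: le_log_iff)

lemma d_bounds: "\<alpha> n * lg \<le> real d" "real d \<le> \<alpha> n * lg + 1" "1 \<le> d"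
proof -
  have pos: "0 < \<alpha> n * lg" using log_ge_1 \<alpha> by simp
  show "\<alpha> n * lg \<le> real d" "real d \<le> \<alpha> n * lg + 1"
    using pos by (simp_all add: kov_dim_def)
  then have "0 < real d" using pos by linarith
  then show "1 \<le> d" by simp
qed

definition Z where "Z = nat \<lceil>lg + \<alpha> n\<rceil>"

lemma Z: "lg + \<alpha> n \<le> real Z" "4 \<le> Z"
proof -
  show *: "lg + \<alpha> n \<le> real Z" unfolding Z_def by linarith
  have "4 \<le> real Z" using * log_ge_1 alpha_ge_4 by linarith
  then show "4 \<le> Z" by simp
qed

lemma w_eq: "w = (k + 10) * Z" by (simp add: word_len_def Z_def)

lemma w_ge: "lg + \<alpha> n \<le> real w" "1 \<le> w"
proof -
  have "Z \<le> w" unfolding w_eq by simp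
  then show "lg + \<alpha> n \<le> real w" "1 \<le> w" using Z by linarith+
qed

text \<open>\<open>X = 2 ^ Z\<close> dominates \<open>n\<close>, \<open>Z\<close> and 16, so each of
  the six summands is at most \<open>X ^ (k + 5)\<close> and their sum is below
  \<open>16 * X ^ (k + 5) \<le> X ^ (k + 6)\<close>. In the word length factor, \<open>k\<close>
  makes room for tuple numbers below \<open>n ^ k\<close> and 10 for the rest.\<close>

lemma fits: "k * n * h + 4 * (n + 1) * (n + 1) + n ^ k + d + w + k < 2 ^ w"
proof -
  define X :: nat where "X = 2 ^ Z"
  have X16: "16 \<le> X" using power_increasing[OF Z(2), of "2 :: nat"] by (simp add: X_def)
  have ZX: "Z \<le> X" using less_exp[of Z] by (simp add: X_def)
  have "real n = 2 powr lg" using n by simp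
  also have "\<dots> \<le> 2 powr real Z" using Z(1) alpha_ge_4 by (intro powr_mono) auto
  also have "\<dots> = real X" by (simp add: X_def powr_realpow)
  finally have nX: "n \<le> X" by simp
  have "\<alpha> n * lg \<le> real Z * real Z" using Z(1) log_ge_1 alpha_ge_4 by (intro mult_mono) auto
  then have "d \<le> Z * Z" by (simp add: kov_dim_def nat_le_iff ceiling_le_iff)
  also have "\<dots> \<le> X * X" using ZX by (intro mult_le_mono)
  finally have dX: "d \<le> X ^ 2" by (simp add: power2_eq_square)
  have hX: "h \<le> X ^ 2" using words_per_row_bounds(1)[of w d] dX w_ge(2) d_bounds(3) by linarith
  have up: "X ^ i \<le> X ^ j" if "i \<le> j" for i j using that X16 by (intro power_increasing) auto
  have kX: "k \<le> X ^ k"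
  proof -
    have "k \<le> 2 ^ k" using less_exp[of k] by simp
    also have "\<dots> \<le> X ^ k" using X16 by (intro power_mono) auto
    finally show ?thesis .
  qed
  have 1: "k * n * h \<le> X ^ (k + 5)"
  proof -
    have "k * n * h \<le> X ^ k * X * X ^ 2" using kX nX hX by (intro mult_le_mono)
    also have "\<dots> = X ^ (k + 3)" by (simp add: power_add power3_eq_cube power2_eq_square)
    finally show ?thesis using up[of "k + 3" "k + 5"] by simp
  qed
  have 2: "4 * (n + 1) * (n + 1) \<le> X ^ (k + 5)"
  proof -
    have "n + 1 \<le> 2 * X" using nX X16 by simp
    also have "\<dots> \<le> X * X" using X16 by (intro mult_le_mono1) simp
    finally have "4 * (n + 1) * (n + 1) \<le> X * (X * X) * (X * X)" using X16 by (intro mult_le_mono) auto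
    also have "\<dots> = X ^ 5" by (simp add: numeral_eq_Suc)
    finally show ?thesis using up[of 5 "k + 5"] by simp
  qed
  have 3: "n ^ k \<le> X ^ (k + 5)"
    using power_mono[OF nX, of k] up[of k "k + 5"] by simp
  have 4: "d \<le> X ^ (k + 5)" using dX up[of 2 "k + 5"] by simp
  have 5: "w \<le> X ^ (k + 5)"
  proof -
    have "k + 10 \<le> X ^ k + X ^ 1" unfolding power_one_right using kX X16 by linarith
    also have "\<dots> \<le> 2 * X ^ (k + 1)" using up[of k "k + 1"] up[of 1 "k + 1"] by linarith
    also have "\<dots> \<le> X * X ^ (k + 1)" using X16 by (intro mult_le_mono1) simp
    finally have "w \<le> (X * X ^ (k + 1)) * X" unfolding w_eq using ZX by (intro mult_le_mono)
    also have "\<dots> = X ^ (k + 3)" by (simp add: power_add power3_eq_cube)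
    finally show ?thesis using up[of "k + 3" "k + 5"] by simp
  qed
  have 6: "k \<le> X ^ (k + 5)" using kX up[of k "k + 5"] by simp
  have "0 < X ^ (k + 5)" using X16 by simp
  then have "k * n * h + 4 * (n + 1) * (n + 1) + n ^ k + d + w + k < 16 * X ^ (k + 5)"
    using 1 2 3 4 5 6 by linarith
  also have "\<dots> \<le> X * X ^ (k + 5)" using X16 by (intro mult_le_mono1)
  also have "\<dots> = X ^ (k + 6)" by (simp add: numeral_eq_Suc)
  also have "\<dots> \<le> X ^ (k + 10)" by (rule up) simp
  also have "\<dots> = 2 ^ w" by (simp add: X_def w_eq mult.commute flip: power_mult)
  finally show ?thesis .
qed

text \<open>\<open>\<rho>\<close> is the probability that a given column of a null-model tuple
  contains a zero.\<close>

lemma rho: "\<rho> = 2 powr (- 2 * real k / \<alpha> n)"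
  using kov_prob_power(2)[of k \<alpha> n] k \<alpha> by simp

lemma rho_power: "\<rho> ^ m = 2 powr (- 2 * real k / \<alpha> n * real m)"
proof -
  have "(2 powr (- 2 * real k / \<alpha> n)) ^ m = (2 powr (- 2 * real k / \<alpha> n)) powr real m"
    by (rule powr_realpow[symmetric]) simp
  then show ?thesis unfolding rho by (simp only: powr_powr)
qed

section \<open>Comparison of each cost with the allowed time\<close>

context
  fixes t :: nat
  assumes t: "4 ^ t \<le> n" "n < 4 ^ Suc t"
begin

lemma t_lg: "2 * real t \<le> lg" "lg < 2 * real t + 2"
proof -
  have pow4: "2 powr (2 * real m) = (4 :: real) ^ m" for m
  proof -
    have "2 powr (2 * real m) = (2 powr 2) powr real m" by (simp only: powr_powr)
    also have "\<dots> = 4 ^ m" by (simp add: powr_realpow)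
    finally show ?thesis .
  qed
  have "real (4 ^ t) \<le> real n" "real n < real (4 ^ Suc t)"
    using t by (simp_all only: of_nat_le_iff of_nat_less_iff)
  then have "2 powr (2 * real t) \<le> real n" "real n < 2 powr (2 * real (Suc t))"
    unfolding pow4 by (simp_all only: of_nat_power of_nat_numeral)
  moreover have "0 < real n" using n by simp
  ultimately have "2 * real t \<le> lg" "lg < 2 * real (Suc t)"
    by (simp_all only: le_log_iff log_less_iff one_less_numeral_iff semiring_norm)
  then show "2 * real t \<le> lg" "lg < 2 * real t + 2" by simp_all
qed

lemma t_le_d: "t \<le> d"
proof -
  have "1 * lg \<le> \<alpha> n * lg" using alpha_ge_4 log_ge_1 by (intro mult_right_mono) auto
  then have "real t \<le> real d" using t_lg d_bounds log_ge_1 by linarith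
  then show ?thesis by simp
qed

lemma kov_run: "kov_run k n d w t"
proof (rule kov_run.intro)
  show "1 \<le> n" using n by simp
qed (rule k d_bounds(3) w_ge(2) t fits)+

abbreviation "G \<equiv> real n powr (real k - real k / (1 + \<alpha> n))"

lemma first_term: "real (n ^ (k - 1) * 2 ^ t) \<le> G"
proof -
  have "2 ^ t = 2 powr real t" by (simp add: powr_realpow)
  also have "\<dots> \<le> 2 powr (lg * (1 / 2))" using t_lg by (intro powr_mono) auto
  also have "\<dots> = (2 powr lg) powr (1 / 2)" by (simp only: powr_powr)
  also have "\<dots> = real n powr (1 / 2)" using n by simp
  finally have "real (n ^ (k - 1) * 2 ^ t) \<le> real n ^ (k - 1) * real n powr (1 / 2)"
    using n by (simp add: mult_left_mono)
  also have "\<dots> = real n powr (real (k - 1) + 1 / 2)"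
    using n by (simp add: powr_add powr_realpow)
  also have "\<dots> \<le> G"
  proof (rule powr_mono)
    have "real k / (1 + \<alpha> n) \<le> 1 / 2" using alpha_ge_2k alpha_ge_4 by (simp add: field_simps)
    then show "real (k - 1) + 1 / 2 \<le> real k - real k / (1 + \<alpha> n)" using k by (simp add: of_nat_diff)
  qed (use n in simp)
  finally show ?thesis .
qed

text \<open>Since \<open>w \<ge> lg + \<alpha>\<close>, a row of about \<open>\<alpha> * lg\<close>
  bits takes at most \<open>lg + 2\<close> words however large \<open>\<alpha>\<close> is, and a
  logarithm is negligible against \<open>2 ^ t\<close>.\<close>

lemma h_bound: "2 + h \<le> 6 * 2 ^ t"
proof -
  have "h * w \<le> d + w" using words_per_row_bounds(2)[of w d] w_ge d_bounds(3) by linarith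
  then have "real h * real w \<le> real d + real w" by (metis of_nat_add of_nat_le_iff of_nat_mult)
  also have "real d \<le> real w * lg + real w"
  proof -
    have "\<alpha> n * lg \<le> real w * lg" using w_ge(1) log_ge_1 by (intro mult_right_mono) auto
    then show ?thesis using d_bounds(2) w_ge(2) by linarith
  qed
  finally have "real w * real h \<le> real w * (lg + 2)" by (simp add: algebra_simps)
  then have "real h \<le> lg + 2" using w_ge(2) by (subst (asm) mult_le_cancel_left_pos) auto
  then have "real h < 2 * real t + 4" using t_lg(2) by linarith
  then have "h < 2 * t + 4" by linarith
  moreover have "t + 1 \<le> 2 ^ t" unfolding Suc_eq_plus1[symmetric] by (intro Suc_leI less_exp)
  ultimately show ?thesis by linarith
qed

text \<open>Rounding \<open>t\<close> down loses less than 2 in \<open>2 * t\<close> against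
  \<open>lg\<close>, hence a factor of at most \<open>2 powr (2 k / \<alpha>) \<le> 2\<close>.
  Replacing \<open>k / \<alpha>\<close> by \<open>k / (1 + \<alpha>)\<close> only weakens the
  bound.\<close>

lemma rho_t: "real (n ^ k) * \<rho> ^ t \<le> 2 * G"
proof -
  have "\<rho> ^ t \<le> 2 powr (1 + - (real k / (1 + \<alpha> n)) * lg)"
    unfolding rho_power
  proof (rule powr_mono)
    have "real k / \<alpha> n * (lg - 2) \<le> real k / \<alpha> n * (2 * real t)"
      using t_lg(2) \<alpha> by (intro mult_left_mono) auto
    moreover have "real k / (1 + \<alpha> n) * lg \<le> real k / \<alpha> n * lg"
      using log_ge_1 \<alpha> by (intro mult_right_mono divide_left_mono) auto
    moreover have "real k / \<alpha> n * 2 \<le> 1" using alpha_ge_2k \<alpha> by (simp add: field_simps)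
    ultimately show "- 2 * real k / \<alpha> n * real t \<le> 1 + - (real k / (1 + \<alpha> n)) * lg"
      by (simp add: algebra_simps)
  qed simp
  also have "\<dots> = 2 * (2 powr lg) powr (- (real k / (1 + \<alpha> n)))"
    unfolding powr_add powr_powr by (simp add: mult.commute)
  also have "\<dots> = 2 * real n powr (- (real k / (1 + \<alpha> n)))" using n by simp
  finally have "real (n ^ k) * \<rho> ^ t \<le> real n powr real k * (2 * real n powr (- (real k / (1 + \<alpha> n))))"
    using n by (simp add: powr_realpow mult_left_mono)
  also have "\<dots> = 2 * G" by (simp add: powr_diff powr_minus_divide)
  finally show ?thesis .
qed

text \<open>For \<open>q \<ge> 1\<close> the first \<open>q\<close> words hold at least
  \<open>t + q * \<alpha>\<close> bits, and \<open>\<alpha>\<close> bits contribute a factor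
  \<open>2 powr (- 2 k) \<le> 1/2\<close>. This is where the term \<open>\<alpha>\<close> in the
  word length enters the probabilities.\<close>

lemma rho_sum: "(\<Sum>q\<in>{1..<h}. \<rho> ^ (q * w)) \<le> \<rho> ^ t"
proof -
  have "\<rho> ^ (q * w) \<le> \<rho> ^ t * (1 / 2) ^ q" if "q \<in> {1..<h}" for q
  proof -
    have "real t + real q * \<alpha> n \<le> real q * (lg + \<alpha> n)"
    proof -
      have "1 * lg \<le> real q * lg" using that log_ge_1 by (intro mult_right_mono) auto
      then show ?thesis using t_lg(1) by (simp add: algebra_simps)
    qed
    also have "\<dots> \<le> real (q * w)" using w_ge(1) by (simp add: mult_left_mono)
    finally have "2 * real k / \<alpha> n * (real t + real q * \<alpha> n) \<le> 2 * real k / \<alpha> n * real (q * w)"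
      using \<alpha> by (intro mult_left_mono) auto
    moreover have "2 * real k / \<alpha> n * (real t + real q * \<alpha> n) = 2 * real k / \<alpha> n * real t + 2 * real k * real q"
      using \<alpha> by (simp add: field_simps)
    moreover have "1 * real q \<le> 2 * real k * real q" using k by (intro mult_right_mono) auto
    ultimately have "- 2 * real k / \<alpha> n * real (q * w) \<le> - 2 * real k / \<alpha> n * real t + - real q"
      by simp
    then have "\<rho> ^ (q * w) \<le> 2 powr (- 2 * real k / \<alpha> n * real t + - real q)"
      unfolding rho_power by (intro powr_mono) auto
    also have "\<dots> = \<rho> ^ t * (1 / 2) ^ q"
    proof -
      have "2 powr (- real q) = (1 / 2 :: real) ^ q"
        by (simp add: powr_minus powr_realpow power_one_over inverse_eq_divide)
      then show ?thesis unfolding rho_power powr_add by (simp only:)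
    qed
    finally show ?thesis .
  qed
  then have "(\<Sum>q\<in>{1..<h}. \<rho> ^ (q * w)) \<le> (\<Sum>q\<in>{1..<h}. \<rho> ^ t * (1 / 2) ^ q)" by (rule sum_mono)
  also have "\<dots> = \<rho> ^ t * (\<Sum>q\<in>{1..<h}. (1 / 2) ^ q)" by (simp add: sum_distrib_left)
  also have "\<dots> \<le> \<rho> ^ t * 1" using sum_half_powers[of h] by (intro mult_left_mono) (auto simp: rho_power)
  finally show ?thesis by simp
qed

text \<open>The 13 is 1 for the first summand, 6 for the tuples through the modified row
  (\<open>h_bound\<close>), and \<open>3 * 2\<close> for the null-model costs
  (\<open>rho_sum\<close> and \<open>rho_t\<close>).\<close>

lemma total_bound:
  "real (n ^ (k - 1) * 2 ^ t) + real (n ^ (k - 1) * (2 + h)) + real (n ^ k) *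
      (2 * \<rho> ^ t + (\<Sum>q\<in>{1..<h}. \<rho> ^ (q * w))) \<le> 13 * G"
proof -
  have "n ^ (k - 1) * (2 + h) \<le> n ^ (k - 1) * (6 * 2 ^ t)" using h_bound by (rule mult_le_mono2)
  then have "real (n ^ (k - 1) * (2 + h)) \<le> real (n ^ (k - 1) * (6 * 2 ^ t))" by (rule of_nat_mono)
  then have "real (n ^ (k - 1) * (2 + h)) \<le> 6 * real (n ^ (k - 1) * 2 ^ t)" by simp
  moreover have "real (n ^ k) * (2 * \<rho> ^ t + (\<Sum>q\<in>{1..<h}. \<rho> ^ (q * w))) \<le> real (n ^ k) * (3 * \<rho> ^ t)"
    using rho_sum by (intro mult_left_mono) auto
  ultimately show ?thesis using first_term rho_t by linarith
qed

end

end

theorem theorem16: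
  fixes k :: nat and \<alpha> :: "nat \<Rightarrow> real"
  assumes "k \<ge> 2"
    and "\<And>n. n \<ge> 1 \<Longrightarrow> \<alpha> n > 0"
    and "\<And>n. n \<ge> 1 \<Longrightarrow> kov_prob k \<alpha> n \<le> 1 / 2"
  shows "\<exists>(P :: ram_prog) (c :: nat) (T :: nat \<Rightarrow> kov_inst \<Rightarrow> nat).
    (\<forall>n\<ge>1. \<forall>U\<in>set_pmf (kov1 k \<alpha> n). \<exists>\<sigma>.
       ram_exec (word_len c \<alpha> n) P
         (input_state (word_len c \<alpha> n) k n (kov_dim \<alpha> n) U) (T n U) \<sigma> \<and>
       (\<forall>l<k. output_of \<sigma> l < n) \<and>
       orthogonal_vecs k (kov_dim \<alpha> n) (\<lambda>l. U l (output_of \<sigma> l))) \<and>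
    (\<lambda>n. measure_pmf.expectation (kov1 k \<alpha> n) (\<lambda>U. real (T n U)))
      \<in> O(\<lambda>n. real n powr (real k - real k / (1 + \<alpha> n)))"
proof -
  let ?w = "word_len (k + 10) \<alpha>" and ?d = "kov_dim \<alpha>"
  let ?h = "\<lambda>n. words_per_row (?w n) (?d n)"
  define good where "good n U u \<longleftrightarrow>
    (\<exists>\<sigma>. ram_exec (?w n) (kov_prog k) (input_state (?w n) k n (?d n) U) u \<sigma> \<and>
      (\<forall>l<k. output_of \<sigma> l < n) \<and> orthogonal_vecs k (?d n) (\<lambda>l. U l (output_of \<sigma> l)))" for n U u
  let ?cost = "\<lambda>n U t. time_const k * (n ^ (k - 1) * 2 ^ t +
    (\<Sum>y<n ^ k. tuple_cost k n (?w n) (?h n) t U y))"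
  have ex_t: "\<exists>t. 4 ^ t \<le> n \<and> n < 4 ^ Suc t" if "1 \<le> n" for n :: nat
    using ex_power_ivl1[of 4 n] that by simp
  have run1: "\<exists>u. good n U u" if "n = 1" for n U
  proof -
    have "?d n = 0" using that by (simp add: kov_dim_def)
    moreover obtain u \<sigma> where "ram_exec (?w n) (kov_prog k) (input_state (?w n) k n 0 U) u \<sigma>"
      "\<forall>l<k. fst \<sigma> l = 0"
      using kov_prog_zero[OF assms(1), of "?w n" n U] unfolding runs_def by blast
    ultimately show ?thesis unfolding good_def output_of_def using that
      by (intro exI[of _ u] exI[of _ \<sigma>]) (simp add: orthogonal_vecs_def)
  qed
  have run2: "\<exists>u. good n U u \<and> u \<le> ?cost n U t"
    if n: "2 \<le> n" and U: "U \<in> set_pmf (kov1 k \<alpha> n)" and t: "4 ^ t \<le> n" "n < 4 ^ Suc t" for n U t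
  proof -
    interpret kov_params k n \<alpha> by unfold_locales (use assms n in auto)
    interpret run: kov_run k n "?d n" "?w n" t U by (rule kov_run[OF t])
    have "0 < n" "0 < k" using n assms(1) by simp_all
    obtain U0 s where s: "\<And>l. l < k \<Longrightarrow> s l < n"
      "U \<in> set_pmf (plant k (?d n) (kov_prob k \<alpha> n) U0 s)"
      by (rule set_kov1[OF U \<open>0 < n\<close>], rule that)
    have s1: "\<forall>l<k. s l < n" using s(1) by simp
    obtain u \<sigma> where "ram_exec (?w n) (kov_prog k) (input_state (?w n) k n (?d n) U) u \<sigma>"
      "u \<le> ?cost n U t" "\<forall>l<k. fst \<sigma> l < n" "orthogonal_vecs k (?d n) (\<lambda>l. U l (fst \<sigma> l))"
      using run.kov_prog_correct[OF s1 plant_orthogonal[OF s(2) \<open>0 < k\<close>] t_le_d[OF t]]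
      unfolding runs_def by (elim exE conjE) (rule that)
    then show ?thesis unfolding good_def output_of_def by (intro exI[of _ u] exI[of _ \<sigma>] conjI)
  qed
  \<comment> \<open>\<open>ram_exec\<close> is deterministic, so at most one time is
    \<open>good\<close>; \<open>LEAST\<close> picks it without reference to
    \<open>t\<close>.\<close>
  define T where "T n U = (LEAST u. good n U u)" for n U
  have good_T: "good n U (T n U)" if "1 \<le> n" and U: "U \<in> set_pmf (kov1 k \<alpha> n)" for n U
  proof -
    have "\<exists>u. good n U u"
    proof (cases "n = 1")
      case False
      then have n: "2 \<le> n" using that(1) by simp
      obtain t where "4 ^ t \<le> n" "n < 4 ^ Suc t"
        using ex_t[OF \<open>1 \<le> n\<close>] by blast
      from run2[OF n U this] show ?thesis by blast
    qed (rule run1)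
    then show ?thesis unfolding T_def by (rule LeastI_ex)
  qed
  have bound: "measure_pmf.expectation (kov1 k \<alpha> n) (\<lambda>U. real (T n U)) \<le>
      13 * real (time_const k) * real n powr (real k - real k / (1 + \<alpha> n))" if n: "2 \<le> n" for n
  proof -
    interpret kov_params k n \<alpha> by unfold_locales (use assms n in auto)
    have "1 \<le> n" using n by simp
    then obtain t where t: "4 ^ t \<le> n" "n < 4 ^ Suc t"
      using ex_t by blast
    have "T n U \<le> ?cost n U t" if U: "U \<in> set_pmf (kov1 k \<alpha> n)" for U
    proof -
      obtain u where u: "good n U u" "u \<le> ?cost n U t" using run2[OF n U t] by blast
      have "T n U \<le> u" unfolding T_def using u(1) by (rule Least_le)
      with u(2) show ?thesis by (rule order_trans[rotated])
    qed
    moreover have "0 < n" "0 < k" "1 \<le> n" using n assms(1) by simp_all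
    moreover from this have "0 \<le> kov_prob k \<alpha> n" "kov_prob k \<alpha> n \<le> 1"
      using kov_prob_power(1)[of k \<alpha> n] assms(2,3)[of n] by linarith+
    ultimately have "measure_pmf.expectation (kov1 k \<alpha> n) (\<lambda>U. real (T n U)) \<le>
      real (time_const k) * (real (n ^ (k - 1) * 2 ^ t) + real (n ^ (k - 1) * (2 + ?h n)) + real (n ^ k) *
        (2 * (1 - kov_prob k \<alpha> n ^ k) ^ t + (\<Sum>q\<in>{1..<?h n}. (1 - kov_prob k \<alpha> n ^ k) ^ (q * ?w n))))"
      using assms(1) mult_le_if_less_words_per_row t_le_d[OF t] by (intro expectation_kov1_le)
    also have "\<dots> \<le> real (time_const k) * (13 * real n powr (real k - real k / (1 + \<alpha> n)))"
      using total_bound[OF t] by (intro mult_left_mono) auto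
    finally show ?thesis by (simp only: mult_ac)
  qed
  have "(\<lambda>n. measure_pmf.expectation (kov1 k \<alpha> n) (\<lambda>U. real (T n U)))
      \<in> O(\<lambda>n. real n powr (real k - real k / (1 + \<alpha> n)))"
  proof (rule bigoI[where c = "13 * real (time_const k)"])
    show "\<forall>\<^sub>F n in at_top. norm (measure_pmf.expectation (kov1 k \<alpha> n) (\<lambda>U. real (T n U))) \<le>
      13 * real (time_const k) * norm (real n powr (real k - real k / (1 + \<alpha> n)))"
      using eventually_ge_at_top[of 2]
    proof eventually_elim
      case (elim n)
      have "0 \<le> measure_pmf.expectation (kov1 k \<alpha> n) (\<lambda>U. real (T n U))"
        by (rule Bochner_Integration.integral_nonneg) simp
      then show ?case using bound[OF elim] by simp
    qed
  qed
  then show ?thesis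
    using good_T unfolding good_def by (intro exI[of _ "kov_prog k"] exI[of _ "k + 10"] exI[of _ T] conjI allI impI ballI)
qed

end
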